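(* Let $(M,\varphi,\xi,\eta,g)$ be a Kenmotsu pseudo-metric manifold of dimension higher than $3$, with $g(\xi,\xi)=\varepsilon\in\{1,-1\}$. Then $M$ is $\varphi$-conformally flat if and only if it is a space of constant curvature $-\varepsilon$.
   Context: Let $M$ be a smooth manifold of dimension $2n+1$, $n\ge 1$. An almost contact pseudo-metric structure $(\varphi,\xi,\eta,g)$ on $M$ consists of a $(1,1)$-tensor field $\varphi$, a vector field $\xi$, a 1-form $\eta$ and a pseudo-Riemannian metric $g$ such that $\varphi^2=-I+\eta\otimes\xi$, $\eta(\xi)=1$, $\varphi\xi=0$, $\eta\circ\varphi=0$, and $g(\varphi X,\varphi Y)=g(X,Y)-\varepsilon\eta(X)\eta(Y)$ for all vector fields $X,Y$, where $\varepsilon=\pm1$; consequently $\eta(X)=\varepsilon g(X,\xi)$, $g(\varphi X,Y)=-g(X,\varphi Y)$ and $g(\xi,\xi)=\varepsilon$. It is a Kenmotsu pseudo-metric manifold if $(\nabla_X\varphi)Y=-\eta(Y)\varphi X-\varepsilon g(X,\varphi Y)\xi$ for all $X,Y$, where $\nabla$ is the Levi-Civita connection of $g$. Curvature: $R(X,Y)=[\nabla_X,\nabla_Y]-\nabla_{[X,Y]}$; $Ric(Y,Z)$ is the trace of $X\mapsto R(X,Y)Z$; the Ricci operator $Q$ is given by $g(QX,Y)=Ric(X,Y)$; $r$ is the scalar curvature (trace of $Q$). The conformal curvature tensor is $$C(X,Y)Z=R(X,Y)Z-\tfrac{1}{2n-1}\{Ric(Y,Z)X+g(Y,Z)QX-Ric(X,Z)Y-g(X,Z)QY\}+\tfrac{r}{2n(2n-1)}\{g(Y,Z)X-g(X,Z)Y\}.$$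 $M$ is $\varphi$-conformally flat if $\varphi^2C(\varphi X,\varphi Y)\varphi Z=0$ for all $X,Y,Z$. Constant curvature $k$ means $R(X,Y)Z=k\{g(Y,Z)X-g(X,Z)Y\}$ for all $X,Y,Z$. *)

theory Defs
  imports "HOL-Analysis.Analysis"
begin

subsection \<open>Smooth maps on open subsets of Euclidean spaces\<close>

text \<open>Both predicates are meant for open sets only.\<close>

primrec Ck_on :: "nat \<Rightarrow> ('a::euclidean_space \<Rightarrow> 'b::real_normed_vector) \<Rightarrow> 'a set \<Rightarrow> bool" where
  "Ck_on 0 f S \<longleftrightarrow> continuous_on S f"
| "Ck_on (Suc k) f S \<longleftrightarrow>
     (\<forall>x\<in>S. f differentiable (at x)) \<and> (\<forall>v. Ck_on k (\<lambda>x. frechet_derivative f (at x) v) S)"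

definition smooth_on :: "'a::euclidean_space set \<Rightarrow> ('a \<Rightarrow> 'b::real_normed_vector) \<Rightarrow> bool" where
  "smooth_on S f \<longleftrightarrow> (\<forall>k. Ck_on k f S)"

subsection \<open>Smooth manifolds\<close>

text \<open>
  The underlying set of the manifold is a whole Hausdorff, second countable type; its smooth
  structure is the one determined by a (not necessarily maximal) smooth atlas. A chart is a pair
  of its domain and its coordinate map; the values of the latter outside of the domain are
  irrelevant. The dimension of the manifold is \<open>DIM('e)\<close>.
\<close>

type_synonym ('m, 'e) chart = "'m set \<times> ('m \<Rightarrow> 'e)"

definition chart_inv :: "('m, 'e) chart \<Rightarrow> 'e \<Rightarrow> 'm" where
  "chart_inv c = inv_into (fst c) (snd c)"

definition is_chart :: "('m::topological_space, 'e::euclidean_space) chart \<Rightarrow> bool" where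
  "is_chart c \<longleftrightarrow> open (fst c) \<and> open (snd c ` fst c) \<and>
     homeomorphism (fst c) (snd c ` fst c) (snd c) (chart_inv c)"

definition smooth_atlas ::
  "('m::{t2_space, second_countable_topology}, 'e::euclidean_space) chart set \<Rightarrow> bool" where
  "smooth_atlas A \<longleftrightarrow>
     (\<forall>c\<in>A. is_chart c) \<and> (\<Union>c\<in>A. fst c) = UNIV \<and>
     (\<forall>c\<in>A. \<forall>d\<in>A. smooth_on (snd c ` (fst c \<inter> fst d)) (snd d \<circ> chart_inv c))"

definition smooth_fun :: "('m, 'e::euclidean_space) chart set \<Rightarrow> ('m \<Rightarrow> real) \<Rightarrow> bool" where
  "smooth_fun A f \<longleftrightarrow> (\<forall>c\<in>A. smooth_on (snd c ` fst c) (f \<circ> chart_inv c))"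

subsection \<open>Tangent vectors and vector fields\<close>

text \<open>
  Every point \<open>p\<close> has a preferred chart \<open>chart_at A p\<close>, and a tangent vector at \<open>p\<close> is given by its
  coordinates with respect to that chart, so that each tangent space is a copy of \<open>'e\<close>. The choice
  of the preferred chart need not depend continuously on \<open>p\<close>; smoothness of a vector field is
  therefore a condition on its components in the charts of the atlas, which are obtained from
  the preferred ones by means of the derivative of the coordinate change.
\<close>

definition chart_at :: "('m, 'e) chart set \<Rightarrow> 'm \<Rightarrow> ('m, 'e) chart" where
  "chart_at A p = (SOME c. c \<in> A \<and> p \<in> fst c)"

definition tangent_coord ::
  "('m, 'e::euclidean_space) chart set \<Rightarrow> ('m, 'e) chart \<Rightarrow> 'm \<Rightarrow> 'e \<Rightarrow> 'e" where
  "tangent_coord A c p v =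
     frechet_derivative (snd c \<circ> chart_inv (chart_at A p)) (at (snd (chart_at A p) p)) v"

definition smooth_vf :: "('m, 'e::euclidean_space) chart set \<Rightarrow> ('m \<Rightarrow> 'e) \<Rightarrow> bool" where
  "smooth_vf A X \<longleftrightarrow>
     (\<forall>c\<in>A. smooth_on (snd c ` fst c)
        (\<lambda>x. tangent_coord A c (chart_inv c x) (X (chart_inv c x))))"

text \<open>The function \<open>X f\<close> for a vector field \<open>X\<close> and a smooth function \<open>f\<close>:\<close>

definition vf_deriv ::
  "('m, 'e::euclidean_space) chart set \<Rightarrow> ('m \<Rightarrow> 'e) \<Rightarrow> ('m \<Rightarrow> real) \<Rightarrow> 'm \<Rightarrow> real" where
  "vf_deriv A X f p =
     frechet_derivative (f \<circ> chart_inv (chart_at A p)) (at (snd (chart_at A p) p)) (X p)"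

definition lie_bracket ::
  "('m, 'e::euclidean_space) chart set \<Rightarrow> ('m \<Rightarrow> 'e) \<Rightarrow> ('m \<Rightarrow> 'e) \<Rightarrow> 'm \<Rightarrow> 'e" where
  "lie_bracket A X Y =
     (THE Z. smooth_vf A Z \<and>
        (\<forall>f. smooth_fun A f \<longrightarrow>
           (\<forall>p. vf_deriv A Z f p =
                 vf_deriv A X (vf_deriv A Y f) p - vf_deriv A Y (vf_deriv A X f) p)))"

subsection \<open>Tensor fields and pseudo-Riemannian metrics\<close>

definition smooth_one_form ::
  "('m, 'e::euclidean_space) chart set \<Rightarrow> ('m \<Rightarrow> 'e \<Rightarrow> real) \<Rightarrow> bool" where
  "smooth_one_form A \<eta> \<longleftrightarrow>
     (\<forall>p. linear (\<eta> p)) \<and> (\<forall>X. smooth_vf A X \<longrightarrow> smooth_fun A (\<lambda>p. \<eta> p (X p)))"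

definition smooth_endo ::
  "('m, 'e::euclidean_space) chart set \<Rightarrow> ('m \<Rightarrow> 'e \<Rightarrow> 'e) \<Rightarrow> bool" where
  "smooth_endo A \<phi> \<longleftrightarrow>
     (\<forall>p. linear (\<phi> p)) \<and> (\<forall>X. smooth_vf A X \<longrightarrow> smooth_vf A (\<lambda>p. \<phi> p (X p)))"

definition form_index :: "('e::euclidean_space \<Rightarrow> 'e \<Rightarrow> real) \<Rightarrow> nat" where
  "form_index b = Max {dim W | W. subspace W \<and> (\<forall>w\<in>W. w \<noteq> 0 \<longrightarrow> b w w < 0)}"

definition pseudo_riemannian_metric ::
  "('m, 'e::euclidean_space) chart set \<Rightarrow> ('m \<Rightarrow> 'e \<Rightarrow> 'e \<Rightarrow> real) \<Rightarrow> bool" where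
  "pseudo_riemannian_metric A g \<longleftrightarrow>
     (\<forall>p. bilinear (g p)) \<and>
     (\<forall>p u v. g p u v = g p v u) \<and>
     (\<forall>p u. (\<forall>v. g p u v = 0) \<longrightarrow> u = 0) \<and>
     (\<forall>X Y. smooth_vf A X \<longrightarrow> smooth_vf A Y \<longrightarrow> smooth_fun A (\<lambda>p. g p (X p) (Y p))) \<and>
     (\<exists>\<nu>. \<forall>p. form_index (g p) = \<nu>)"

subsection \<open>The Levi-Civita connection\<close>

definition affine_connection ::
  "('m, 'e::euclidean_space) chart set \<Rightarrow> (('m \<Rightarrow> 'e) \<Rightarrow> ('m \<Rightarrow> 'e) \<Rightarrow> 'm \<Rightarrow> 'e) \<Rightarrow> bool" where
  "affine_connection A nabla \<longleftrightarrow>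
     (\<forall>X Y. smooth_vf A X \<longrightarrow> smooth_vf A Y \<longrightarrow> smooth_vf A (nabla X Y)) \<and>
     (\<forall>X X' Y. smooth_vf A X \<longrightarrow> smooth_vf A X' \<longrightarrow> smooth_vf A Y \<longrightarrow>
        nabla (\<lambda>p. X p + X' p) Y = (\<lambda>p. nabla X Y p + nabla X' Y p)) \<and>
     (\<forall>f X Y. smooth_fun A f \<longrightarrow> smooth_vf A X \<longrightarrow> smooth_vf A Y \<longrightarrow>
        nabla (\<lambda>p. f p *\<^sub>R X p) Y = (\<lambda>p. f p *\<^sub>R nabla X Y p)) \<and>
     (\<forall>X Y Y'. smooth_vf A X \<longrightarrow> smooth_vf A Y \<longrightarrow> smooth_vf A Y' \<longrightarrow>
        nabla X (\<lambda>p. Y p + Y' p) = (\<lambda>p. nabla X Y p + nabla X Y' p)) \<and>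
     (\<forall>f X Y. smooth_fun A f \<longrightarrow> smooth_vf A X \<longrightarrow> smooth_vf A Y \<longrightarrow>
        nabla X (\<lambda>p. f p *\<^sub>R Y p) = (\<lambda>p. f p *\<^sub>R nabla X Y p + vf_deriv A X f p *\<^sub>R Y p))"

text \<open>
  A Levi-Civita connection is determined by \<open>g\<close> on smooth vector fields; its values on
  non-smooth arguments are unconstrained and never used.
\<close>

definition levi_civita ::
  "('m, 'e::euclidean_space) chart set \<Rightarrow> ('m \<Rightarrow> 'e \<Rightarrow> 'e \<Rightarrow> real) \<Rightarrow>
   (('m \<Rightarrow> 'e) \<Rightarrow> ('m \<Rightarrow> 'e) \<Rightarrow> 'm \<Rightarrow> 'e) \<Rightarrow> bool" where
  "levi_civita A g nabla \<longleftrightarrow>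
     affine_connection A nabla \<and>
     (\<forall>X Y p. smooth_vf A X \<longrightarrow> smooth_vf A Y \<longrightarrow>
        nabla X Y p - nabla Y X p = lie_bracket A X Y p) \<and>
     (\<forall>X Y Z p. smooth_vf A X \<longrightarrow> smooth_vf A Y \<longrightarrow> smooth_vf A Z \<longrightarrow>
        vf_deriv A X (\<lambda>q. g q (Y q) (Z q)) p = g p (nabla X Y p) (Z p) + g p (Y p) (nabla X Z p))"

subsection \<open>Curvature\<close>

definition curvature ::
  "('m, 'e::euclidean_space) chart set \<Rightarrow> (('m \<Rightarrow> 'e) \<Rightarrow> ('m \<Rightarrow> 'e) \<Rightarrow> 'm \<Rightarrow> 'e) \<Rightarrow>
   ('m \<Rightarrow> 'e) \<Rightarrow> ('m \<Rightarrow> 'e) \<Rightarrow> ('m \<Rightarrow> 'e) \<Rightarrow> 'm \<Rightarrow> 'e" where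
  "curvature A nabla X Y Z p = nabla X (nabla Y Z) p - nabla Y (nabla X Z) p - nabla (lie_bracket A X Y) Z p"

text \<open>
  An operator \<open>T\<close> on smooth vector fields that is linear over the smooth functions induces an
  endomorphism of each tangent space, by extending tangent vectors arbitrarily to smooth vector
  fields. Its trace at \<open>p\<close> is the trace of this endomorphism, computed here in the standard
  orthonormal basis of \<open>'e\<close>.
\<close>

definition endo_at ::
  "('m, 'e::euclidean_space) chart set \<Rightarrow> (('m \<Rightarrow> 'e) \<Rightarrow> 'm \<Rightarrow> 'e) \<Rightarrow> 'm \<Rightarrow> 'e \<Rightarrow> 'e" where
  "endo_at A T p v = T (SOME X. smooth_vf A X \<and> X p = v) p"

definition trace_at ::
  "('m, 'e::euclidean_space) chart set \<Rightarrow> (('m \<Rightarrow> 'e) \<Rightarrow> 'm \<Rightarrow> 'e) \<Rightarrow> 'm \<Rightarrow> real" where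
  "trace_at A T p = (\<Sum>b\<in>Basis. endo_at A T p b \<bullet> b)"

definition ricci ::
  "('m, 'e::euclidean_space) chart set \<Rightarrow> (('m \<Rightarrow> 'e) \<Rightarrow> ('m \<Rightarrow> 'e) \<Rightarrow> 'm \<Rightarrow> 'e) \<Rightarrow>
   ('m \<Rightarrow> 'e) \<Rightarrow> ('m \<Rightarrow> 'e) \<Rightarrow> 'm \<Rightarrow> real" where
  "ricci A nabla Y Z p = trace_at A (\<lambda>X. curvature A nabla X Y Z) p"

definition ricci_op ::
  "('m, 'e::euclidean_space) chart set \<Rightarrow> ('m \<Rightarrow> 'e \<Rightarrow> 'e \<Rightarrow> real) \<Rightarrow>
   (('m \<Rightarrow> 'e) \<Rightarrow> ('m \<Rightarrow> 'e) \<Rightarrow> 'm \<Rightarrow> 'e) \<Rightarrow> ('m \<Rightarrow> 'e) \<Rightarrow> 'm \<Rightarrow> 'e" where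
  "ricci_op A g nabla X p = (THE w. \<forall>Y. smooth_vf A Y \<longrightarrow> g p w (Y p) = ricci A nabla X Y p)"

definition scalar_curvature ::
  "('m, 'e::euclidean_space) chart set \<Rightarrow> ('m \<Rightarrow> 'e \<Rightarrow> 'e \<Rightarrow> real) \<Rightarrow>
   (('m \<Rightarrow> 'e) \<Rightarrow> ('m \<Rightarrow> 'e) \<Rightarrow> 'm \<Rightarrow> 'e) \<Rightarrow> 'm \<Rightarrow> real" where
  "scalar_curvature A g nabla p = trace_at A (ricci_op A g nabla) p"

text \<open>The conformal curvature tensor in dimension \<open>2 * n + 1\<close>:\<close>

definition conformal_curvature ::
  "nat \<Rightarrow> ('m, 'e::euclidean_space) chart set \<Rightarrow> ('m \<Rightarrow> 'e \<Rightarrow> 'e \<Rightarrow> real) \<Rightarrow>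
   (('m \<Rightarrow> 'e) \<Rightarrow> ('m \<Rightarrow> 'e) \<Rightarrow> 'm \<Rightarrow> 'e) \<Rightarrow>
   ('m \<Rightarrow> 'e) \<Rightarrow> ('m \<Rightarrow> 'e) \<Rightarrow> ('m \<Rightarrow> 'e) \<Rightarrow> 'm \<Rightarrow> 'e" where
  "conformal_curvature n A g nabla X Y Z p =
     curvature A nabla X Y Z p
     - (1 / (2 * real n - 1)) *\<^sub>R
         (ricci A nabla Y Z p *\<^sub>R X p + g p (Y p) (Z p) *\<^sub>R ricci_op A g nabla X p
          - ricci A nabla X Z p *\<^sub>R Y p - g p (X p) (Z p) *\<^sub>R ricci_op A g nabla Y p)
     + (scalar_curvature A g nabla p / (2 * real n * (2 * real n - 1))) *\<^sub>R
         (g p (Y p) (Z p) *\<^sub>R X p - g p (X p) (Z p) *\<^sub>R Y p)"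

definition constant_curvature ::
  "('m, 'e::euclidean_space) chart set \<Rightarrow> ('m \<Rightarrow> 'e \<Rightarrow> 'e \<Rightarrow> real) \<Rightarrow>
   (('m \<Rightarrow> 'e) \<Rightarrow> ('m \<Rightarrow> 'e) \<Rightarrow> 'm \<Rightarrow> 'e) \<Rightarrow> real \<Rightarrow> bool" where
  "constant_curvature A g nabla k \<longleftrightarrow>
     (\<forall>X Y Z p. smooth_vf A X \<longrightarrow> smooth_vf A Y \<longrightarrow> smooth_vf A Z \<longrightarrow>
        curvature A nabla X Y Z p = k *\<^sub>R (g p (Y p) (Z p) *\<^sub>R X p - g p (X p) (Z p) *\<^sub>R Y p))"

subsection \<open>Kenmotsu pseudo-metric manifolds\<close>

definition almost_contact_pseudo_metric ::
  "('m, 'e::euclidean_space) chart set \<Rightarrow> ('m \<Rightarrow> 'e \<Rightarrow> 'e) \<Rightarrow> ('m \<Rightarrow> 'e) \<Rightarrow> ('m \<Rightarrow> 'e \<Rightarrow> real) \<Rightarrow>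
   ('m \<Rightarrow> 'e \<Rightarrow> 'e \<Rightarrow> real) \<Rightarrow> real \<Rightarrow> bool" where
  "almost_contact_pseudo_metric A \<phi> \<xi> \<eta> g \<epsilon> \<longleftrightarrow>
     smooth_endo A \<phi> \<and> smooth_vf A \<xi> \<and> smooth_one_form A \<eta> \<and> pseudo_riemannian_metric A g \<and>
     (\<epsilon> = 1 \<or> \<epsilon> = -1) \<and>
     (\<forall>p v. \<phi> p (\<phi> p v) = - v + \<eta> p v *\<^sub>R \<xi> p) \<and>
     (\<forall>p. \<eta> p (\<xi> p) = 1) \<and>
     (\<forall>p. \<phi> p (\<xi> p) = 0) \<and>
     (\<forall>p v. \<eta> p (\<phi> p v) = 0) \<and>
     (\<forall>X Y p. smooth_vf A X \<longrightarrow> smooth_vf A Y \<longrightarrow>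
        g p (\<phi> p (X p)) (\<phi> p (Y p)) = g p (X p) (Y p) - \<epsilon> * \<eta> p (X p) * \<eta> p (Y p))"

definition kenmotsu_pseudo_metric ::
  "('m, 'e::euclidean_space) chart set \<Rightarrow> ('m \<Rightarrow> 'e \<Rightarrow> 'e) \<Rightarrow> ('m \<Rightarrow> 'e) \<Rightarrow> ('m \<Rightarrow> 'e \<Rightarrow> real) \<Rightarrow>
   ('m \<Rightarrow> 'e \<Rightarrow> 'e \<Rightarrow> real) \<Rightarrow> real \<Rightarrow> (('m \<Rightarrow> 'e) \<Rightarrow> ('m \<Rightarrow> 'e) \<Rightarrow> 'm \<Rightarrow> 'e) \<Rightarrow> bool" where
  "kenmotsu_pseudo_metric A \<phi> \<xi> \<eta> g \<epsilon> nabla \<longleftrightarrow>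
     almost_contact_pseudo_metric A \<phi> \<xi> \<eta> g \<epsilon> \<and> levi_civita A g nabla \<and>
     (\<forall>X Y p. smooth_vf A X \<longrightarrow> smooth_vf A Y \<longrightarrow>
        nabla X (\<lambda>q. \<phi> q (Y q)) p - \<phi> p (nabla X Y p) =
          - (\<eta> p (Y p) *\<^sub>R \<phi> p (X p)) - (\<epsilon> * g p (X p) (\<phi> p (Y p))) *\<^sub>R \<xi> p)"

definition phi_conformally_flat ::
  "nat \<Rightarrow> ('m, 'e::euclidean_space) chart set \<Rightarrow> ('m \<Rightarrow> 'e \<Rightarrow> 'e) \<Rightarrow>
   ('m \<Rightarrow> 'e \<Rightarrow> 'e \<Rightarrow> real) \<Rightarrow> (('m \<Rightarrow> 'e) \<Rightarrow> ('m \<Rightarrow> 'e) \<Rightarrow> 'm \<Rightarrow> 'e) \<Rightarrow> bool" where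
  "phi_conformally_flat n A \<phi> g nabla \<longleftrightarrow>
     (\<forall>X Y Z p. smooth_vf A X \<longrightarrow> smooth_vf A Y \<longrightarrow> smooth_vf A Z \<longrightarrow>
        \<phi> p (\<phi> p (conformal_curvature n A g nabla
          (\<lambda>q. \<phi> q (X q)) (\<lambda>q. \<phi> q (Y q)) (\<lambda>q. \<phi> q (Z q)) p)) = 0)"

end

theory Submission
  imports Defs
begin

text \<open>
  Write \<open>B(u,v)w = g(v,w)u - g(u,w)v\<close> for the curvature tensor of a space of constant curvature
  one, and put \<open>T = R + \<epsilon> B\<close>. The manifold has constant curvature \<open>-\<epsilon>\<close> iff \<open>T = 0\<close>, and the
  conformal tensor is a linear function of \<open>R\<close> that vanishes on \<open>B\<close>, so it is the conformal tensor
  of \<open>T\<close> as well (\<open>weyl_of_shift\<close>). In particular \<open>T = 0\<close> makes the manifold \<open>\<phi>\<close>-conformally flat.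

  The Kenmotsu condition prescribes \<open>\<nabla>\<phi>\<close> and, evaluated on \<open>\<xi>\<close>, also \<open>\<nabla>\<xi>\<close>; differentiating both once
  more gives \<open>R(X,Y)\<xi> = \<eta>(X)Y - \<eta>(Y)X\<close> (\<open>R_\<xi>\<close>) and a formula for the commutator of \<open>R(X,Y)\<close> and
  \<open>\<phi>\<close> (\<open>R_\<phi>\<close>). In terms of \<open>T\<close> these say exactly that \<open>T(X,Y)\<xi> = 0\<close> and that \<open>T(X,Y)\<close> commutes
  with \<open>\<phi>\<close>. Together with the symmetries of curvature tensors the first one shows that \<open>T\<close> vanishes
  as soon as one of its arguments is \<open>\<xi>\<close>, so \<open>T\<close> lives on the horizontal space \<open>D = ker \<eta>\<close>, of
  dimension \<open>2n\<close>.

  The rest is linear algebra in one tangent space (\<open>flat_imp_zero\<close>). Flatness says that the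
  conformal tensor of \<open>T\<close> is zero on \<open>D\<close>. Its coefficients are those of dimension \<open>2n + 1\<close>, while
  \<open>D\<close> has dimension \<open>2n\<close>; because of this mismatch the contraction over \<open>D\<close> is not trivial, and it
  forces the Ricci form of \<open>T\<close> to be the multiple \<open>\<sigma>/(2n)\<close> of \<open>g\<close> on \<open>D\<close>, where \<open>\<sigma>\<close> is its trace. Then
  \<open>T = k B\<close> on \<open>D\<close> for a number \<open>k\<close>. But \<open>B\<close> commutes with \<open>\<phi>\<close> only if \<open>D\<close> is a plane: taking a trace
  of the commutation relation leaves \<open>k (2n - 2) g(v,v) = 0\<close> for horizontal \<open>v\<close>. As \<open>n \<ge> 2\<close> and as
  \<open>g\<close> is not zero on \<open>D\<close>, \<open>k = 0\<close> and so \<open>T = 0\<close>.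

  To pass from vector fields to tangent vectors, operators that are linear over the smooth functions
  have to be shown to be pointwise (\<open>tensorial\<close>), which takes bump functions, and the Lie bracket has
  to be constructed from coordinates (\<open>lie_bracket_exists\<close>), which takes the symmetry of second
  derivatives. The identities of a Levi-Civita curvature tensor follow as usual.
\<close>


section \<open>Smooth maps between Euclidean spaces\<close>

lemma Ck_on_cong:
  assumes "open S" "\<And>x. x \<in> S \<Longrightarrow> f x = g x" "Ck_on k f S"
  shows "Ck_on k g S"
  using assms(2,3)
proof (induction k arbitrary: f g)
  case 0
  then show ?case using continuous_on_cong[of S S f g] by simp
next
  case (Suc k)
  have d: "(f has_derivative frechet_derivative f (at x)) (at x)" if "x \<in> S" for x
    using Suc.prems(2) that by (auto simp: frechet_derivative_works)
  have d': "(g has_derivative frechet_derivative f (at x)) (at x)" if "x \<in> S" for x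
    using has_derivative_transform_within_open[OF d[OF that] \<open>open S\<close> that Suc.prems(1)] .
  have e: "frechet_derivative g (at x) = frechet_derivative f (at x)" if "x \<in> S" for x
    using frechet_derivative_at[OF d'[OF that]] by simp
  show ?case
  proof (simp, intro conjI ballI allI)
    fix x assume "x \<in> S"
    then show "g differentiable at x" by (rule differentiableI[OF d'])
  next
    fix v
    have "Ck_on k (\<lambda>x. frechet_derivative f (at x) v) S" using Suc.prems(2) by simp
    then show "Ck_on k (\<lambda>x. frechet_derivative g (at x) v) S"
      by (rule Suc.IH[rotated]) (simp add: e)
  qed
qed

lemma Ck_on_subset: "Ck_on k f S \<Longrightarrow> T \<subseteq> S \<Longrightarrow> Ck_on k f T"
  by (induction k arbitrary: f) (auto intro: continuous_on_subset)

lemma Ck_on_SucD: "Ck_on (Suc k) f S \<Longrightarrow> Ck_on k f S"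
proof (induction k arbitrary: f)
  case 0
  then show ?case
    by (auto intro!: differentiable_imp_continuous_on differentiable_at_imp_differentiable_on)
next
  case (Suc k)
  then have *: "\<forall>x\<in>S. f differentiable (at x)"
      "\<And>v. Ck_on (Suc k) (\<lambda>x. frechet_derivative f (at x) v) S" by auto
  have "Ck_on k (\<lambda>x. frechet_derivative f (at x) v) S" for v
    by (rule Suc.IH[OF *(2)])
  with *(1) show ?case by simp
qed

text \<open>
  Smoothness may be checked near each point. This is what allows a function or a vector field to be
  extended by zero from a chart to the manifold.
\<close>

lemma Ck_on_local:
  assumes "\<And>x. x \<in> S \<Longrightarrow> \<exists>U. open U \<and> x \<in> U \<and> Ck_on k f U"
  shows "Ck_on k f S"
  using assms
proof (induction k arbitrary: f)
  case 0
  have "isCont f x" if "x \<in> S" for x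
    using 0[OF that] by (auto simp: continuous_on_eq_continuous_at)
  then show ?case by (simp add: continuous_at_imp_continuous_on)
next
  case (Suc k)
  show ?case
  proof (simp, intro conjI ballI allI)
    fix x assume "x \<in> S"
    then show "f differentiable at x" using Suc.prems by auto
  next
    fix v show "Ck_on k (\<lambda>x. frechet_derivative f (at x) v) S"
    proof (rule Suc.IH)
      fix x assume "x \<in> S"
      from Suc.prems[OF this]
      show "\<exists>U. open U \<and> x \<in> U \<and> Ck_on k (\<lambda>x. frechet_derivative f (at x) v) U" by auto
    qed
  qed
qed

lemma Ck_on_const: "Ck_on k (\<lambda>x. c) S"
  by (induction k arbitrary: c) auto

lemma Ck_on_bounded_linear:
  assumes "open S" "bounded_linear h" "Ck_on k f S"
  shows "Ck_on k (\<lambda>x. h (f x)) S"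
  using assms(3)
proof (induction k arbitrary: f)
  case 0
  then show ?case by (simp add: bounded_linear.continuous_on[OF assms(2)])
next
  case (Suc k)
  have d: "((\<lambda>x. h (f x)) has_derivative (\<lambda>v. h (frechet_derivative f (at x) v))) (at x)"
    if "x \<in> S" for x
    using Suc.prems that assms(2)
    by (auto intro!: bounded_linear.has_derivative[OF assms(2)] simp: frechet_derivative_works)
  show ?case
  proof (simp, intro conjI ballI allI)
    fix x assume "x \<in> S"
    then show "(\<lambda>x. h (f x)) differentiable at x" by (rule differentiableI[OF d])
  next
    fix v
    have "Ck_on k (\<lambda>x. h (frechet_derivative f (at x) v)) S"
      using Suc by auto
    then show "Ck_on k (\<lambda>x. frechet_derivative (\<lambda>x. h (f x)) (at x) v) S"
      by (rule Ck_on_cong[OF assms(1), rotated])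
         (simp add: frechet_derivative_at[OF d, symmetric])
  qed
qed

lemma Ck_on_id: "Ck_on k (\<lambda>x. x) S"
  by (cases k) (auto intro: Ck_on_const)

lemma Ck_on_add:
  assumes "open S" "Ck_on k f S" "Ck_on k g S"
  shows "Ck_on k (\<lambda>x. f x + g x) S"
  using assms(2,3)
proof (induction k arbitrary: f g)
  case 0
  then show ?case by (auto intro: continuous_intros)
next
  case (Suc k)
  have d: "((\<lambda>x. f x + g x) has_derivative
      (\<lambda>v. frechet_derivative f (at x) v + frechet_derivative g (at x) v)) (at x)"
    if "x \<in> S" for x
    using Suc.prems that
    by (auto intro!: has_derivative_add simp: frechet_derivative_works)
  show ?case
  proof (simp, intro conjI ballI allI)
    fix x assume "x \<in> S"
    then show "(\<lambda>x. f x + g x) differentiable at x" by (rule differentiableI[OF d])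
  next
    fix v
    have "Ck_on k (\<lambda>x. frechet_derivative f (at x) v + frechet_derivative g (at x) v) S"
      using Suc by auto
    then show "Ck_on k (\<lambda>x. frechet_derivative (\<lambda>x. f x + g x) (at x) v) S"
      by (rule Ck_on_cong[OF assms(1), rotated])
         (simp add: frechet_derivative_at[OF d, symmetric])
  qed
qed

lemma Ck_on_bilinear:
  assumes "open S" "bounded_bilinear m" "Ck_on k f S" "Ck_on k g S"
  shows "Ck_on k (\<lambda>x. m (f x) (g x)) S"
  using assms(3,4)
proof (induction k arbitrary: f g)
  case 0
  then show ?case by (simp add: bounded_bilinear.continuous_on[OF assms(2)])
next
  case (Suc k)
  have d: "((\<lambda>x. m (f x) (g x)) has_derivative
      (\<lambda>v. m (f x) (frechet_derivative g (at x) v) + m (frechet_derivative f (at x) v) (g x))) (at x)"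
    if "x \<in> S" for x
    using Suc.prems that assms(2)
    by (auto intro!: bounded_bilinear.FDERIV[OF assms(2)] simp: frechet_derivative_works)
  have fg: "Ck_on k f S" "Ck_on k g S" by (fact Suc.prems[THEN Ck_on_SucD])+
  show ?case
  proof (simp, intro conjI ballI allI)
    fix x assume "x \<in> S"
    then show "(\<lambda>x. m (f x) (g x)) differentiable at x" by (rule differentiableI[OF d])
  next
    fix v
    have "Ck_on k (\<lambda>x. m (f x) (frechet_derivative g (at x) v) + m (frechet_derivative f (at x) v) (g x)) S"
      using Suc.prems by (intro Ck_on_add[OF assms(1)] Suc.IH fg) auto
    then show "Ck_on k (\<lambda>x. frechet_derivative (\<lambda>x. m (f x) (g x)) (at x) v) S"
      by (rule Ck_on_cong[OF assms(1), rotated])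
         (simp add: frechet_derivative_at[OF d, symmetric])
  qed
qed

lemma Ck_on_sum:
  assumes "open S" "\<And>i. i \<in> I \<Longrightarrow> Ck_on k (f i) S"
  shows "Ck_on k (\<lambda>x. \<Sum>i\<in>I. f i x) S"
  using assms(2)
proof (induction I rule: infinite_finite_induct)
  case (insert i I)
  then show ?case by (simp add: Ck_on_add[OF assms(1)])
qed (auto intro: Ck_on_const)

lemma frechet_derivative_Basis_sum:
  assumes "f differentiable (at x)"
  shows "frechet_derivative f (at x) v = (\<Sum>b\<in>Basis. (v \<bullet> b) *\<^sub>R frechet_derivative f (at x) b)"
proof -
  have l: "linear (frechet_derivative f (at x))" by (rule linear_frechet_derivative[OF assms])
  have "frechet_derivative f (at x) v = frechet_derivative f (at x) (\<Sum>b\<in>Basis. (v \<bullet> b) *\<^sub>R b)"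
    by (simp add: euclidean_representation)
  also have "\<dots> = (\<Sum>b\<in>Basis. (v \<bullet> b) *\<^sub>R frechet_derivative f (at x) b)"
    by (simp add: linear_sum[OF l] linear_cmul[OF l])
  finally show ?thesis .
qed

text \<open>
  The chain rule writes the derivative of a composition as a finite sum, over the standard basis, of
  components of the derivative of \<open>h\<close> times partial derivatives of \<open>f\<close> composed with \<open>h\<close>, so that
  the product rule and the induction hypothesis for the partial derivatives apply.
\<close>

lemma Ck_on_compose:
  assumes "open S" "open T" "h ` S \<subseteq> T" "Ck_on k h S" "Ck_on k f T"
  shows "Ck_on k (\<lambda>x. f (h x)) S"
  using assms(4,5)
proof (induction k arbitrary: f)
  case 0
  then show ?case using continuous_on_compose2[of T f S h] assms(3) by simp
next
  case (Suc k)
  have d: "((\<lambda>x. f (h x)) has_derivative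
      (\<lambda>v. frechet_derivative f (at (h x)) (frechet_derivative h (at x) v))) (at x)"
    if "x \<in> S" for x
  proof -
    have 1: "(h has_derivative frechet_derivative h (at x)) (at x)"
      using Suc.prems that by (simp add: frechet_derivative_works)
    have 2: "(f has_derivative frechet_derivative f (at (h x))) (at (h x))"
      using Suc.prems that assms(3) by (simp add: frechet_derivative_works image_subset_iff)
    show ?thesis by (rule has_derivative_compose[OF 1 2])
  qed
  have h: "Ck_on k h S" by (rule Ck_on_SucD[OF Suc.prems(1)])
  show ?case
  proof (simp, intro conjI ballI allI)
    fix x assume x: "x \<in> S"
    show "(\<lambda>x. f (h x)) differentiable at x" by (rule differentiableI, rule d[OF x])
  next
    fix v
    have "Ck_on k (\<lambda>x. \<Sum>b\<in>Basis. (frechet_derivative h (at x) v \<bullet> b) *\<^sub>R frechet_derivative f (at (h x)) b) S"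
    proof (rule Ck_on_sum[OF assms(1)])
      fix b :: 'b
      have 1: "Ck_on k (\<lambda>x. frechet_derivative h (at x) v \<bullet> b) S"
        by (rule Ck_on_bounded_linear[OF assms(1) bounded_linear_inner_left]) (use Suc.prems in simp)
      have 2: "Ck_on k (\<lambda>x. frechet_derivative f (at (h x)) b) S"
        by (rule Suc.IH[OF h]) (use Suc.prems in simp)
      show "Ck_on k (\<lambda>x. (frechet_derivative h (at x) v \<bullet> b) *\<^sub>R frechet_derivative f (at (h x)) b) S"
        by (rule Ck_on_bilinear[OF assms(1) bounded_bilinear_scaleR 1 2])
    qed
    then show "Ck_on k (\<lambda>x. frechet_derivative (\<lambda>x. f (h x)) (at x) v) S"
    proof (rule Ck_on_cong[OF assms(1), rotated])
      fix x assume x: "x \<in> S"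
      have "f differentiable (at (h x))" using Suc.prems x assms(3) by auto
      show "(\<Sum>b\<in>Basis. (frechet_derivative h (at x) v \<bullet> b) *\<^sub>R frechet_derivative f (at (h x)) b)
         = frechet_derivative (\<lambda>x. f (h x)) (at x) v"
        by (rule trans[OF frechet_derivative_Basis_sum[OF \<open>f differentiable (at (h x))\<close>, symmetric]
              fun_cong[OF frechet_derivative_at[OF d[OF x]]]])
    qed
  qed
qed

lemma smooth_onI: "(\<And>k. Ck_on k f S) \<Longrightarrow> smooth_on S f"
  by (simp add: smooth_on_def)

lemma smooth_on_cong:
  "open S \<Longrightarrow> (\<And>x. x \<in> S \<Longrightarrow> f x = g x) \<Longrightarrow> smooth_on S f \<Longrightarrow> smooth_on S g"
  using Ck_on_cong unfolding smooth_on_def by blast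

lemma smooth_on_subset: "smooth_on S f \<Longrightarrow> T \<subseteq> S \<Longrightarrow> smooth_on T f"
  using Ck_on_subset unfolding smooth_on_def by blast

lemma smooth_on_local:
  "(\<And>x. x \<in> S \<Longrightarrow> \<exists>U. open U \<and> x \<in> U \<and> smooth_on U f) \<Longrightarrow> smooth_on S f"
  unfolding smooth_on_def by (meson Ck_on_local)

lemma smooth_on_const: "smooth_on S (\<lambda>x. c)"
  by (simp add: smooth_on_def Ck_on_const)

lemma smooth_on_id: "smooth_on S (\<lambda>x. x)"
  by (simp add: smooth_on_def Ck_on_id)

lemma smooth_on_bounded_linear:
  "open S \<Longrightarrow> bounded_linear h \<Longrightarrow> smooth_on S f \<Longrightarrow> smooth_on S (\<lambda>x. h (f x))"
  by (simp add: smooth_on_def Ck_on_bounded_linear)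

lemma smooth_on_add:
  "open S \<Longrightarrow> smooth_on S f \<Longrightarrow> smooth_on S g \<Longrightarrow> smooth_on S (\<lambda>x. f x + g x)"
  by (simp add: smooth_on_def Ck_on_add)

lemma smooth_on_bilinear:
  "open S \<Longrightarrow> bounded_bilinear m \<Longrightarrow> smooth_on S f \<Longrightarrow> smooth_on S g \<Longrightarrow> smooth_on S (\<lambda>x. m (f x) (g x))"
  by (simp add: smooth_on_def Ck_on_bilinear)

lemmas smooth_on_scaleR = smooth_on_bilinear[OF _ bounded_bilinear_scaleR]
lemmas smooth_on_mult = smooth_on_bilinear[OF _ bounded_bilinear_mult]
lemmas smooth_on_inner = smooth_on_bilinear[OF _ bounded_bilinear_inner]

lemma smooth_on_uminus: "open S \<Longrightarrow> smooth_on S f \<Longrightarrow> smooth_on S (\<lambda>x. - f x)"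
  by (rule smooth_on_bounded_linear[OF _ bounded_linear_minus[OF bounded_linear_ident]])

lemma smooth_on_diff:
  "open S \<Longrightarrow> smooth_on S f \<Longrightarrow> smooth_on S g \<Longrightarrow> smooth_on S (\<lambda>x. f x - g x)"
  using smooth_on_add[of S f "\<lambda>x. - g x"] smooth_on_uminus[of S g] by simp

lemma smooth_on_sum:
  "open S \<Longrightarrow> (\<And>i. i \<in> I \<Longrightarrow> smooth_on S (f i)) \<Longrightarrow> smooth_on S (\<lambda>x. \<Sum>i\<in>I. f i x)"
  by (simp add: smooth_on_def Ck_on_sum)

lemma smooth_on_compose:
  "open S \<Longrightarrow> open T \<Longrightarrow> h ` S \<subseteq> T \<Longrightarrow> smooth_on S h \<Longrightarrow> smooth_on T f \<Longrightarrow> smooth_on S (\<lambda>x. f (h x))"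
  by (simp add: smooth_on_def Ck_on_compose)

lemma smooth_on_differentiable: "smooth_on S f \<Longrightarrow> x \<in> S \<Longrightarrow> f differentiable (at x)"
  unfolding smooth_on_def by (metis Ck_on.simps(2))

lemma smooth_on_has_derivative:
  "smooth_on S f \<Longrightarrow> x \<in> S \<Longrightarrow> (f has_derivative frechet_derivative f (at x)) (at x)"
  using smooth_on_differentiable frechet_derivative_works by blast

lemma smooth_on_linear_derivative:
  "smooth_on S f \<Longrightarrow> x \<in> S \<Longrightarrow> linear (frechet_derivative f (at x))"
  by (meson linear_frechet_derivative smooth_on_differentiable)

lemma smooth_on_derivative_const: "smooth_on S f \<Longrightarrow> smooth_on S (\<lambda>x. frechet_derivative f (at x) v)"
  unfolding smooth_on_def by (metis Ck_on.simps(2))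

lemma smooth_on_derivative:
  assumes "open S" "smooth_on S f" "smooth_on S X"
  shows "smooth_on S (\<lambda>x. frechet_derivative f (at x) (X x))"
proof -
  have "smooth_on S (\<lambda>x. \<Sum>b\<in>Basis. (X x \<bullet> b) *\<^sub>R frechet_derivative f (at x) b)"
    using assms by (intro smooth_on_sum smooth_on_scaleR smooth_on_inner smooth_on_const
        smooth_on_derivative_const)
  then show ?thesis
    by (rule smooth_on_cong[OF assms(1), rotated])
       (simp add: frechet_derivative_Basis_sum[OF smooth_on_differentiable[OF assms(2)], symmetric])
qed

text \<open>
  The product rule for a directional derivative of \<open>f\<close> whose direction varies with the point. The
  first summand is the second derivative of \<open>f\<close>, symmetric by \<open>second_derivative_symmetric\<close>; this
  is the computation behind the Lie bracket.
\<close>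

lemma has_derivative_frechet_derivative_along:
  assumes "open S" "smooth_on S f" "smooth_on S X" "x \<in> S"
  shows "((\<lambda>y. frechet_derivative f (at y) (X y)) has_derivative
     (\<lambda>u. frechet_derivative (\<lambda>y. frechet_derivative f (at y) (X x)) (at x) u
        + frechet_derivative f (at x) (frechet_derivative X (at x) u))) (at x)"
proof -
  let ?D = "\<lambda>b y. frechet_derivative f (at y) b"
  let ?X' = "frechet_derivative X (at x)"
  have dD: "(?D b has_derivative frechet_derivative (?D b) (at x)) (at x)" for b
    using smooth_on_derivative_const[OF assms(2)] assms(4) smooth_on_has_derivative by blast
  have dX: "(X has_derivative ?X') (at x)"
    using assms smooth_on_has_derivative by blast
  have 1: "((\<lambda>y. \<Sum>b\<in>Basis. (X y \<bullet> b) *\<^sub>R ?D b y) has_derivative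
     (\<lambda>u. \<Sum>b\<in>Basis. (X x \<bullet> b) *\<^sub>R frechet_derivative (?D b) (at x) u + (?X' u \<bullet> b) *\<^sub>R ?D b x)) (at x)"
    by (intro has_derivative_sum has_derivative_scaleR has_derivative_inner_left dX dD)
  have 2: "((\<lambda>y. ?D (X y) y) has_derivative
     (\<lambda>u. \<Sum>b\<in>Basis. (X x \<bullet> b) *\<^sub>R frechet_derivative (?D b) (at x) u + (?X' u \<bullet> b) *\<^sub>R ?D b x)) (at x)"
    by (rule has_derivative_transform_within_open[OF 1 assms(1,4)])
       (simp add: frechet_derivative_Basis_sum[OF smooth_on_differentiable[OF assms(2)], symmetric])
  have 3: "((\<lambda>y. \<Sum>b\<in>Basis. (X x \<bullet> b) *\<^sub>R ?D b y) has_derivative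
     (\<lambda>u. \<Sum>b\<in>Basis. (X x \<bullet> b) *\<^sub>R frechet_derivative (?D b) (at x) u)) (at x)"
    by (intro has_derivative_sum has_derivative_scaleR_right dD)
  have "(?D (X x) has_derivative
     (\<lambda>u. \<Sum>b\<in>Basis. (X x \<bullet> b) *\<^sub>R frechet_derivative (?D b) (at x) u)) (at x)"
    by (rule has_derivative_transform_within_open[OF 3 assms(1,4)])
       (simp add: frechet_derivative_Basis_sum[OF smooth_on_differentiable[OF assms(2)], symmetric])
  then have 4: "frechet_derivative (?D (X x)) (at x) =
     (\<lambda>u. \<Sum>b\<in>Basis. (X x \<bullet> b) *\<^sub>R frechet_derivative (?D b) (at x) u)"
    by (simp add: frechet_derivative_at[symmetric])
  have 5: "?D (?X' u) x = (\<Sum>b\<in>Basis. (?X' u \<bullet> b) *\<^sub>R ?D b x)" for u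
    by (rule frechet_derivative_Basis_sum) (use assms smooth_on_differentiable in blast)
  show ?thesis using 2 by (simp add: 4 5 sum.distrib)
qed

section \<open>Symmetry of second derivatives\<close>

text \<open>
  The second difference over the parallelogram spanned by \<open>t u\<close> and \<open>t v\<close> is symmetric in \<open>u\<close> and \<open>v\<close>,
  and applying the mean value theorem once in each direction turns it into a mixed second
  derivative at a nearby point.
\<close>

lemma second_difference_eq:
  fixes f :: "'a::euclidean_space \<Rightarrow> real"
  assumes f: "smooth_on S f" and t: "t > 0"
    and seg: "\<And>s r. 0 \<le> s \<Longrightarrow> s \<le> t \<Longrightarrow> 0 \<le> r \<Longrightarrow> r \<le> t \<Longrightarrow> x + s *\<^sub>R u + r *\<^sub>R v \<in> S"
  shows "\<exists>s r. 0 \<le> s \<and> s \<le> t \<and> 0 \<le> r \<and> r \<le> t \<and>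
    f (x + t *\<^sub>R u + t *\<^sub>R v) - f (x + t *\<^sub>R u) - f (x + t *\<^sub>R v) + f x =
    t * t * frechet_derivative (\<lambda>y. frechet_derivative f (at y) u) (at (x + s *\<^sub>R u + r *\<^sub>R v)) v"
proof -
  have line: "((\<lambda>s. h (a + s *\<^sub>R w)) has_real_derivative frechet_derivative h (at (a + s *\<^sub>R w)) w) (at s)"
    if h: "smooth_on S h" and s: "a + s *\<^sub>R w \<in> S" for h :: "'a \<Rightarrow> real" and a w s
  proof -
    have 1: "((\<lambda>s. a + s *\<^sub>R w) has_derivative (\<lambda>r. r *\<^sub>R w)) (at s)"
      by (auto intro!: derivative_eq_intros)
    have 2: "(h has_derivative frechet_derivative h (at (a + s *\<^sub>R w))) (at (a + s *\<^sub>R w))"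
      by (rule smooth_on_has_derivative[OF h s])
    have "((\<lambda>s. h (a + s *\<^sub>R w)) has_derivative
        (\<lambda>r. frechet_derivative h (at (a + s *\<^sub>R w)) (r *\<^sub>R w))) (at s)"
      by (rule has_derivative_compose[OF 1 2])
    then show ?thesis
      by (simp add: linear_cmul[OF smooth_on_linear_derivative[OF h s]] has_field_derivative_def mult_commute_abs)
  qed
  let ?D = "\<lambda>y. frechet_derivative f (at y) u"
  have D: "smooth_on S ?D" by (rule smooth_on_derivative_const[OF f])
  have comm: "x + s *\<^sub>R u + r *\<^sub>R v = (x + r *\<^sub>R v) + s *\<^sub>R u" for s r by simp
  have "\<exists>s>0. s < t \<and> (f ((x + t *\<^sub>R v) + t *\<^sub>R u) - f (x + t *\<^sub>R u)) - (f ((x + t *\<^sub>R v) + 0 *\<^sub>R u) - f (x + 0 *\<^sub>R u)) =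
      (t - 0) * (?D ((x + t *\<^sub>R v) + s *\<^sub>R u) - ?D (x + s *\<^sub>R u))"
  proof (rule MVT2[OF t])
    fix s assume s: "0 \<le> s" "s \<le> t"
    have "(x + t *\<^sub>R v) + s *\<^sub>R u \<in> S" using seg[of s t] s t by (simp add: comm)
    moreover have "x + s *\<^sub>R u \<in> S" using seg[of s 0] s t by simp
    ultimately show "((\<lambda>s. f ((x + t *\<^sub>R v) + s *\<^sub>R u) - f (x + s *\<^sub>R u)) has_real_derivative
      ?D ((x + t *\<^sub>R v) + s *\<^sub>R u) - ?D (x + s *\<^sub>R u)) (at s)"
      by (intro DERIV_diff line[OF f])
  qed
  then obtain s where s: "s > 0" "s < t" and 1:
    "f (x + t *\<^sub>R u + t *\<^sub>R v) - f (x + t *\<^sub>R u) - f (x + t *\<^sub>R v) + f x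
       = t * (?D (x + s *\<^sub>R u + t *\<^sub>R v) - ?D (x + s *\<^sub>R u))"
    by (auto simp: algebra_simps)
  have "\<exists>r>0. r < t \<and> ?D (x + s *\<^sub>R u + t *\<^sub>R v) - ?D (x + s *\<^sub>R u + 0 *\<^sub>R v) =
      (t - 0) * frechet_derivative ?D (at (x + s *\<^sub>R u + r *\<^sub>R v)) v"
    using s by (intro MVT2[OF t] line[OF D] seg) auto
  then obtain r where "r > 0" "r < t" "?D (x + s *\<^sub>R u + t *\<^sub>R v) - ?D (x + s *\<^sub>R u) =
      t * frechet_derivative ?D (at (x + s *\<^sub>R u + r *\<^sub>R v)) v" by auto
  with s show ?thesis unfolding 1 by (intro exI[of _ s] exI[of _ r]) simp
qed

text \<open>
  Both mixed derivatives are limits, by continuity, of the same second difference divided by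
  \<open>t\<^sup>2\<close>.
\<close>

lemma second_derivative_symmetric_real:
  fixes f :: "'a::euclidean_space \<Rightarrow> real"
  assumes S: "open S" "x \<in> S" and f: "smooth_on S f"
  shows "frechet_derivative (\<lambda>y. frechet_derivative f (at y) u) (at x) v =
         frechet_derivative (\<lambda>y. frechet_derivative f (at y) v) (at x) u"
proof -
  define G where "G u v y = frechet_derivative (\<lambda>y. frechet_derivative f (at y) u) (at y) v" for u v y
  have cont: "isCont (G u v) x" for u v
  proof -
    have "smooth_on S (G u v)"
      unfolding G_def by (intro smooth_on_derivative_const f)
    then have "Ck_on 0 (G u v) S" unfolding smooth_on_def by blast
    then show ?thesis using S continuous_on_eq_continuous_at by auto
  qed
  have "\<bar>G u v x - G v u x\<bar> \<le> e" if e: "e > 0" for e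
  proof -
    obtain d1 where d1: "d1 > 0" "ball x d1 \<subseteq> S" using S open_contains_ball by blast
    have *: "\<exists>d>0. \<forall>y. dist y x < d \<longrightarrow> \<bar>G u v y - G u v x\<bar> < e/2" for u v
      using cont[of u v] e unfolding continuous_at_eps_delta dist_real_def
      by (metis half_gt_zero)
    obtain d2 where d2: "d2 > 0" "\<And>y. dist y x < d2 \<Longrightarrow> \<bar>G u v y - G u v x\<bar> < e/2"
      using *[of u v] by blast
    obtain d3 where d3: "d3 > 0" "\<And>y. dist y x < d3 \<Longrightarrow> \<bar>G v u y - G v u x\<bar> < e/2"
      using *[of v u] by blast
    define d where "d = min d1 (min d2 d3)"
    have d: "d > 0" using d1 d2 d3 by (simp add: d_def)
    define t where "t = d / (norm u + norm v + 1)"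
    have n: "norm u + norm v + 1 > 0" by (smt (verit) norm_ge_zero)
    have t: "t > 0" using d n by (simp add: t_def)
    have near: "dist (x + s *\<^sub>R u + r *\<^sub>R v) x < d" if "0 \<le> s" "s \<le> t" "0 \<le> r" "r \<le> t" for s r
    proof -
      have "dist (x + s *\<^sub>R u + r *\<^sub>R v) x = norm (s *\<^sub>R u + r *\<^sub>R v)"
        by (simp add: dist_norm add.assoc)
      also have "\<dots> \<le> s * norm u + r * norm v"
        using norm_triangle_ineq[of "s *\<^sub>R u" "r *\<^sub>R v"] that by simp
      also have "\<dots> \<le> t * norm u + t * norm v"
        using that by (intro add_mono mult_right_mono) auto
      also have "\<dots> < t * (norm u + norm v + 1)" using t by (simp add: algebra_simps)
      also have "\<dots> = d" using n by (simp add: t_def)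
      finally show ?thesis .
    qed
    have inS: "x + s *\<^sub>R u + r *\<^sub>R v \<in> S" if "0 \<le> s" "s \<le> t" "0 \<le> r" "r \<le> t" for s r
      using near[OF that] d1 by (auto simp: d_def dist_commute)
    have inS': "x + s *\<^sub>R v + r *\<^sub>R u \<in> S" if "0 \<le> s" "s \<le> t" "0 \<le> r" "r \<le> t" for s r
      using inS[of r s] that by (simp add: add.commute add.left_commute)
    let ?\<Delta> = "f (x + t *\<^sub>R u + t *\<^sub>R v) - f (x + t *\<^sub>R u) - f (x + t *\<^sub>R v) + f x"
    obtain s r where 1: "0 \<le> s" "s \<le> t" "0 \<le> r" "r \<le> t" "?\<Delta> = t * t * G u v (x + s *\<^sub>R u + r *\<^sub>R v)"
      using second_difference_eq[OF f t inS] unfolding G_def by blast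
    obtain s' r' where 2: "0 \<le> s'" "s' \<le> t" "0 \<le> r'" "r' \<le> t"
      "f (x + t *\<^sub>R v + t *\<^sub>R u) - f (x + t *\<^sub>R v) - f (x + t *\<^sub>R u) + f x = t * t * G v u (x + s' *\<^sub>R v + r' *\<^sub>R u)"
      using second_difference_eq[OF f t inS'] unfolding G_def by blast
    have c: "x + a *\<^sub>R v + b *\<^sub>R u = x + b *\<^sub>R u + a *\<^sub>R v" for a b by simp
    have "t * t * G u v (x + s *\<^sub>R u + r *\<^sub>R v) = t * t * G v u (x + r' *\<^sub>R u + s' *\<^sub>R v)"
      using 1(5) 2(5)[unfolded c] by linarith
    then have "G u v (x + s *\<^sub>R u + r *\<^sub>R v) = G v u (x + r' *\<^sub>R u + s' *\<^sub>R v)" using t by simp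
    moreover have "\<bar>G u v (x + s *\<^sub>R u + r *\<^sub>R v) - G u v x\<bar> < e/2"
      using near[OF 1(1-4)] by (intro d2(2)) (simp add: d_def)
    moreover have "\<bar>G v u (x + r' *\<^sub>R u + s' *\<^sub>R v) - G v u x\<bar> < e/2"
      using near[OF 2(3,4,1,2)] by (intro d3(2)) (simp add: d_def)
    ultimately show ?thesis by linarith
  qed
  then have "\<bar>G u v x - G v u x\<bar> \<le> 0" by (rule field_le_epsilon) simp
  then show ?thesis by (simp add: G_def)
qed

lemma second_derivative_symmetric:
  fixes f :: "'a::euclidean_space \<Rightarrow> 'b::euclidean_space"
  assumes S: "open S" "x \<in> S" and f: "smooth_on S f"
  shows "frechet_derivative (\<lambda>y. frechet_derivative f (at y) u) (at x) v =
         frechet_derivative (\<lambda>y. frechet_derivative f (at y) v) (at x) u"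
proof (rule euclidean_eqI)
  fix b :: 'b
  have comp: "frechet_derivative (\<lambda>y. h y \<bullet> b) (at y) w = frechet_derivative h (at y) w \<bullet> b"
    if "smooth_on S h" "y \<in> S" for h :: "'a \<Rightarrow> 'b" and y w
    using frechet_derivative_at[OF has_derivative_inner_left[OF smooth_on_has_derivative[OF that]]]
    by (rule fun_cong[OF sym])
  have fb: "smooth_on S (\<lambda>y. f y \<bullet> b)"
    by (rule smooth_on_inner[OF S(1) f smooth_on_const])
  have *: "frechet_derivative (\<lambda>y. frechet_derivative f (at y) u) (at x) v \<bullet> b =
    frechet_derivative (\<lambda>y. frechet_derivative (\<lambda>y. f y \<bullet> b) (at y) u) (at x) v" for u v
  proof -
    have "frechet_derivative (\<lambda>y. frechet_derivative f (at y) u) (at x) v \<bullet> b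
       = frechet_derivative (\<lambda>y. frechet_derivative f (at y) u \<bullet> b) (at x) v"
      by (rule comp[OF smooth_on_derivative_const[OF f] S(2), symmetric])
    also have "frechet_derivative (\<lambda>y. frechet_derivative f (at y) u \<bullet> b) (at x) =
        frechet_derivative (\<lambda>y. frechet_derivative (\<lambda>y. f y \<bullet> b) (at y) u) (at x)"
    proof (rule frechet_derivative_transform_within_open[OF _ S])
      show "(\<lambda>y. frechet_derivative f (at y) u \<bullet> b) differentiable at x"
        by (rule smooth_on_differentiable[OF smooth_on_inner[OF S(1) smooth_on_derivative_const[OF f] smooth_on_const] S(2)])
    qed (simp add: comp[OF f])
    finally show ?thesis .
  qed
  show "frechet_derivative (\<lambda>y. frechet_derivative f (at y) u) (at x) v \<bullet> b =
         frechet_derivative (\<lambda>y. frechet_derivative f (at y) v) (at x) u \<bullet> b"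
    unfolding * by (rule second_derivative_symmetric_real[OF S fb])
qed

section \<open>Smooth bump functions\<close>

text \<open>
  For \<open>m = 0\<close> this is the standard smooth function that is flat at the origin. The powers of \<open>1/t\<close>
  are there because the derivative of each member of the family is a linear combination of members,
  which turns smoothness into an induction on the order of differentiability for all \<open>m\<close> at once.
\<close>

definition flat_exp :: "nat \<Rightarrow> real \<Rightarrow> real" where
  "flat_exp m t = (if t \<le> 0 then 0 else (1 / t) ^ m * exp (- (1 / t)))"

lemma flat_exp_tendsto_0: "(flat_exp m \<longlongrightarrow> 0) (at 0)"
proof -
  have 1: "((\<lambda>t. (inverse t) ^ m / exp (inverse t)) \<longlongrightarrow> (0::real)) (at_right 0)"
    by (rule filterlim_compose[OF tendsto_power_div_exp_0 filterlim_inverse_at_top_right])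
  have "\<forall>\<^sub>F t in at_right 0. (inverse t) ^ m / exp (inverse t) = flat_exp m t"
    unfolding eventually_at_right_field
    by (rule exI[of _ 1]) (auto simp: flat_exp_def exp_minus field_simps)
  with 1 have "(flat_exp m \<longlongrightarrow> 0) (at_right 0)"
    using tendsto_cong by fast
  moreover have "(flat_exp m \<longlongrightarrow> 0) (at_left 0)"
  proof (rule tendsto_eventually)
    show "\<forall>\<^sub>F t in at_left 0. flat_exp m t = 0"
      unfolding eventually_at_left_field by (rule exI[of _ "-1"]) (auto simp: flat_exp_def)
  qed
  ultimately show ?thesis by (simp add: filterlim_at_split)
qed

lemma flat_exp_deriv:
  "(flat_exp m has_real_derivative flat_exp (m + 2) t - real m * flat_exp (m + 1) t) (at t)"
proof (cases t "0::real" rule: linorder_cases)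
  case less
  have "((\<lambda>t. 0) has_real_derivative 0) (at t)" by simp
  then have "(flat_exp m has_real_derivative 0) (at t)"
    by (rule has_field_derivative_transform_within_open[where S="{..<0}"]) (use less in \<open>auto simp: flat_exp_def\<close>)
  then show ?thesis using less by (simp add: flat_exp_def)
next
  case greater
  have "((\<lambda>t. (1 / t) ^ m * exp (- (1 / t))) has_real_derivative
     flat_exp (m + 2) t - real m * flat_exp (m + 1) t) (at t)"
  proof -
    define q where "q = 1 / t"
    have D: "((\<lambda>t. 1 / t) has_real_derivative - (q * q)) (at t)"
      using greater by (auto intro!: derivative_eq_intros simp: q_def)
    have "((\<lambda>t. (1 / t) ^ m * exp (- (1 / t))) has_real_derivative
       (real m * (- (q * q) * q ^ (m - Suc 0))) * exp (- q) + exp (- q) * (- (- (q * q))) * q ^ m) (at t)"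
      unfolding q_def by (intro DERIV_mult DERIV_power DERIV_fun_exp DERIV_minus D[unfolded q_def])
    also have "(real m * (- (q * q) * q ^ (m - Suc 0))) * exp (- q) + exp (- q) * (- (- (q * q))) * q ^ m
       = flat_exp (m + 2) t - real m * flat_exp (m + 1) t"
      using greater by (cases m) (simp_all add: flat_exp_def q_def[symmetric] algebra_simps)
    finally show ?thesis .
  qed
  then show ?thesis
    by (rule has_field_derivative_transform_within_open[where S="{0<..}"]) (use greater in \<open>auto simp: flat_exp_def\<close>)
next
  case equal
  have "(flat_exp m y - flat_exp m 0) / (y - 0) = flat_exp (Suc m) y" if "y \<noteq> 0" for y
    using that by (auto simp: flat_exp_def field_simps)
  then have "\<forall>\<^sub>F y in at 0. flat_exp (Suc m) y = (flat_exp m y - flat_exp m 0) / (y - 0)"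
    by (auto simp: eventually_at_filter)
  then have "((\<lambda>y. (flat_exp m y - flat_exp m 0) / (y - 0)) \<longlongrightarrow> 0) (at 0)"
    using flat_exp_tendsto_0[of "Suc m"] tendsto_cong by fast
  then show ?thesis by (simp add: has_field_derivative_iff equal flat_exp_def)
qed

lemma Ck_on_flat_exp: "Ck_on k (flat_exp m) UNIV"
proof (induction k arbitrary: m)
  case 0
  show ?case
    using flat_exp_deriv[THEN DERIV_isCont] by (simp add: continuous_at_imp_continuous_on)
next
  case (Suc k)
  have d: "(flat_exp m has_derivative (\<lambda>v. (flat_exp (m + 2) t + (- real m) * flat_exp (m + 1) t) * v)) (at t)" for t
    using flat_exp_deriv[of m t] by (simp add: has_field_derivative_def)
  have "Ck_on k (\<lambda>t. (flat_exp (m + 2) t + (- real m) * flat_exp (m + 1) t) * v) UNIV" for v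
    by (rule Ck_on_bilinear[OF open_UNIV bounded_bilinear_mult Ck_on_add[OF open_UNIV Suc.IH
        Ck_on_bilinear[OF open_UNIV bounded_bilinear_mult Ck_on_const Suc.IH]] Ck_on_const])
  then show ?case
    using differentiableI[OF d] by (simp add: frechet_derivative_at[OF d, symmetric])
qed

lemma bump_function:
  fixes x :: "'a::euclidean_space"
  assumes "open U" "x \<in> U"
  obtains h :: "'a \<Rightarrow> real" and r where "smooth_on UNIV h" "h x = 1" "cball x r \<subseteq> U"
    "\<And>y. y \<notin> cball x r \<Longrightarrow> h y = 0"
proof -
  obtain r where r: "r > 0" "cball x r \<subseteq> U" using assms open_contains_cball by blast
  define h where "h y = flat_exp 0 (r\<^sup>2 - (y - x) \<bullet> (y - x)) * (1 / flat_exp 0 (r\<^sup>2))" for y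
  have "smooth_on UNIV (\<lambda>y. r\<^sup>2 - (y - x) \<bullet> (y - x))"
    by (intro smooth_on_diff smooth_on_inner smooth_on_const smooth_on_id open_UNIV)
  from smooth_on_compose[OF open_UNIV open_UNIV subset_UNIV this smooth_onI[OF Ck_on_flat_exp]]
  have "smooth_on UNIV (\<lambda>y. flat_exp 0 (r\<^sup>2 - (y - x) \<bullet> (y - x)))" .
  then have "smooth_on UNIV h"
    unfolding h_def by (intro smooth_on_mult smooth_on_const open_UNIV)
  moreover have "h x = 1" using r by (simp add: h_def flat_exp_def)
  moreover have "h y = 0" if "y \<notin> cball x r" for y
  proof -
    have "r < norm (y - x)" using that by (simp add: dist_norm norm_minus_commute)
    then have "r\<^sup>2 \<le> (norm (y - x))\<^sup>2" using r by (intro power_mono) auto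
    then show ?thesis by (simp add: h_def flat_exp_def power2_norm_eq_inner)
  qed
  ultimately show thesis using r that by blast
qed

section \<open>Charts, smooth functions and vector fields\<close>

locale atlas =
  fixes A :: "('m::{t2_space, second_countable_topology}, 'e::euclidean_space) chart set"
  assumes atlas: "smooth_atlas A"
begin

definition chart_jacobian :: "('m, 'e) chart \<Rightarrow> ('m, 'e) chart \<Rightarrow> 'm \<Rightarrow> 'e \<Rightarrow> 'e" where
  "chart_jacobian c d p = frechet_derivative (snd d \<circ> chart_inv c) (at (snd c p))"

definition vf_rep :: "('m, 'e) chart \<Rightarrow> ('m \<Rightarrow> 'e) \<Rightarrow> 'e \<Rightarrow> 'e" where
  "vf_rep c X x = tangent_coord A c (chart_inv c x) (X (chart_inv c x))"

lemma is_chart: "c \<in> A \<Longrightarrow> is_chart c"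
  using atlas by (simp add: smooth_atlas_def)

lemma open_chart_domain: "c \<in> A \<Longrightarrow> open (fst c)"
  and open_chart_image: "c \<in> A \<Longrightarrow> open (snd c ` fst c)"
  using is_chart by (auto simp: is_chart_def)

lemma chart_inv_left: "c \<in> A \<Longrightarrow> p \<in> fst c \<Longrightarrow> chart_inv c (snd c p) = p"
  using is_chart[of c] by (simp add: is_chart_def homeomorphism_def)

lemma chart_inv_right: "c \<in> A \<Longrightarrow> x \<in> snd c ` fst c \<Longrightarrow> snd c (chart_inv c x) = x"
  using is_chart[of c] unfolding is_chart_def homeomorphism_def by blast

lemma chart_inv_mem: "c \<in> A \<Longrightarrow> x \<in> snd c ` fst c \<Longrightarrow> chart_inv c x \<in> fst c"
  by (auto simp: chart_inv_left)

lemma continuous_on_chart_inv: "c \<in> A \<Longrightarrow> continuous_on (snd c ` fst c) (chart_inv c)"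
  using is_chart[of c] by (simp add: is_chart_def homeomorphism_def)

lemma open_chart_image_Int:
  assumes c: "c \<in> A" and U: "open U"
  shows "open (snd c ` (fst c \<inter> U))"
proof -
  have "snd c ` (fst c \<inter> U) = snd c ` fst c \<inter> chart_inv c -` U"
    using chart_inv_left[OF c] by force
  then show ?thesis
    using continuous_open_preimage[OF continuous_on_chart_inv[OF c] open_chart_image[OF c] U] by simp
qed

lemma smooth_on_transition:
  "c \<in> A \<Longrightarrow> d \<in> A \<Longrightarrow> smooth_on (snd c ` (fst c \<inter> fst d)) (snd d \<circ> chart_inv c)"
  using atlas by (simp add: smooth_atlas_def)

lemma chart_at_mem: "chart_at A p \<in> A" and mem_chart_at: "p \<in> fst (chart_at A p)"
proof -
  have "\<exists>c. c \<in> A \<and> p \<in> fst c" using atlas by (force simp: smooth_atlas_def)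
  then have "chart_at A p \<in> A \<and> p \<in> fst (chart_at A p)"
    unfolding chart_at_def by (rule someI_ex)
  then show "chart_at A p \<in> A" "p \<in> fst (chart_at A p)" by auto
qed

lemma tangent_coord_eq: "tangent_coord A c p v = chart_jacobian (chart_at A p) c p v"
  by (simp add: tangent_coord_def chart_jacobian_def)

lemma transition_has_derivative:
  assumes "c \<in> A" "d \<in> A" "p \<in> fst c" "p \<in> fst d"
  shows "((snd d \<circ> chart_inv c) has_derivative chart_jacobian c d p) (at (snd c p))"
  unfolding chart_jacobian_def
  by (rule smooth_on_has_derivative[OF smooth_on_transition[OF assms(1,2)]]) (use assms in auto)

lemma linear_chart_jacobian:
  assumes "c \<in> A" "d \<in> A" "p \<in> fst c" "p \<in> fst d"
  shows "linear (chart_jacobian c d p)"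
  using transition_has_derivative[OF assms] has_derivative_linear by blast

text \<open>
  The chain rule for a coordinate change. With \<open>h\<close> the coordinate map of a third chart it becomes the
  cocycle law of the Jacobians, and with a smooth function it shows that derivatives along a vector
  field can be computed in any chart.
\<close>

lemma derivative_change_chart:
  assumes cd: "c \<in> A" "d \<in> A" "p \<in> fst c" "p \<in> fst d"
    and h: "((h \<circ> chart_inv d) has_derivative h') (at (snd d p))"
  shows "((h \<circ> chart_inv c) has_derivative (\<lambda>v. h' (chart_jacobian c d p v))) (at (snd c p))"
proof -
  have h2: "((h \<circ> chart_inv d) has_derivative h') (at ((snd d \<circ> chart_inv c) (snd c p)))"
    using h cd by (simp add: chart_inv_left)
  have *: "((\<lambda>x. (h \<circ> chart_inv d) ((snd d \<circ> chart_inv c) x)) has_derivative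
      (\<lambda>v. h' (chart_jacobian c d p v))) (at (snd c p))"
    by (rule has_derivative_compose[OF transition_has_derivative[OF cd] h2])
  show ?thesis
  proof (rule has_derivative_transform_within_open[OF *])
    show "open (snd c ` (fst c \<inter> fst d))" using cd open_chart_image_Int open_chart_domain by blast
    show "snd c p \<in> snd c ` (fst c \<inter> fst d)" using cd by auto
  qed (use cd in \<open>auto simp: chart_inv_left\<close>)
qed

lemma chart_jacobian_chain:
  assumes "c \<in> A" "d \<in> A" "e \<in> A" "p \<in> fst c" "p \<in> fst d" "p \<in> fst e"
  shows "chart_jacobian d e p (chart_jacobian c d p v) = chart_jacobian c e p v"
  unfolding chart_jacobian_def[of c e]
  using frechet_derivative_at[OF derivative_change_chart[OF assms(1,2,4,5)
        transition_has_derivative[OF assms(2,3,5,6)]]]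
  by (rule fun_cong)

lemma chart_jacobian_self:
  assumes "c \<in> A" "p \<in> fst c"
  shows "chart_jacobian c c p v = v"
proof -
  have "((snd c \<circ> chart_inv c) has_derivative (\<lambda>v. v)) (at (snd c p))"
    by (rule has_derivative_transform_within_open[OF has_derivative_ident open_chart_image[OF assms(1)]])
       (use assms in \<open>auto simp: chart_inv_left\<close>)
  from fun_cong[OF frechet_derivative_at[OF this], of v] show ?thesis by (simp add: chart_jacobian_def)
qed

lemma linear_tangent_coord: "c \<in> A \<Longrightarrow> p \<in> fst c \<Longrightarrow> linear (tangent_coord A c p)"
  using linear_chart_jacobian[OF chart_at_mem _ mem_chart_at]
  by (simp add: tangent_coord_eq[abs_def])

lemma tangent_coord_change:
  "c \<in> A \<Longrightarrow> d \<in> A \<Longrightarrow> p \<in> fst c \<Longrightarrow> p \<in> fst d \<Longrightarrow>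
    tangent_coord A d p v = chart_jacobian c d p (tangent_coord A c p v)"
  by (simp add: tangent_coord_eq chart_jacobian_chain chart_at_mem mem_chart_at)

text \<open>
  The inverse of \<open>tangent_coord\<close>: from components in the chart \<open>c\<close> to components in the preferred
  chart at \<open>p\<close>.
\<close>

definition tangent_vec :: "('m, 'e) chart \<Rightarrow> 'm \<Rightarrow> 'e \<Rightarrow> 'e" where
  "tangent_vec c p w = chart_jacobian c (chart_at A p) p w"

lemma tangent_coord_vec:
  "c \<in> A \<Longrightarrow> p \<in> fst c \<Longrightarrow> tangent_coord A c p (tangent_vec c p w) = w"
  by (simp add: tangent_coord_eq tangent_vec_def chart_jacobian_chain chart_at_mem mem_chart_at
      chart_jacobian_self)

lemma tangent_vec_coord:
  "c \<in> A \<Longrightarrow> p \<in> fst c \<Longrightarrow> tangent_vec c p (tangent_coord A c p v) = v"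
  by (simp add: tangent_coord_eq tangent_vec_def chart_jacobian_chain chart_at_mem mem_chart_at
      chart_jacobian_self)

lemma linear_tangent_vec: "c \<in> A \<Longrightarrow> p \<in> fst c \<Longrightarrow> linear (tangent_vec c p)"
  using linear_chart_jacobian[OF _ chart_at_mem _ mem_chart_at] by (simp add: tangent_vec_def[abs_def])

lemma smooth_vf_iff: "smooth_vf A X \<longleftrightarrow> (\<forall>c\<in>A. smooth_on (snd c ` fst c) (vf_rep c X))"
  by (simp add: smooth_vf_def vf_rep_def[abs_def])

lemma smooth_vf_rep: "smooth_vf A X \<Longrightarrow> c \<in> A \<Longrightarrow> smooth_on (snd c ` fst c) (vf_rep c X)"
  by (simp add: smooth_vf_iff)

lemma smooth_fun_rep: "smooth_fun A f \<Longrightarrow> c \<in> A \<Longrightarrow> smooth_on (snd c ` fst c) (f \<circ> chart_inv c)"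
  by (simp add: smooth_fun_def)

lemma vf_rep_at: "c \<in> A \<Longrightarrow> p \<in> fst c \<Longrightarrow> vf_rep c X (snd c p) = tangent_coord A c p (X p)"
  by (simp add: vf_rep_def chart_inv_left)

lemma vf_rep_change:
  "c \<in> A \<Longrightarrow> d \<in> A \<Longrightarrow> p \<in> fst c \<Longrightarrow> p \<in> fst d \<Longrightarrow>
    vf_rep d X (snd d p) = chart_jacobian c d p (vf_rep c X (snd c p))"
  by (simp add: vf_rep_at tangent_coord_change[of c d])

lemma smooth_vfI:
  assumes "\<And>c. c \<in> A \<Longrightarrow> smooth_on (snd c ` fst c) (V c)"
    and "\<And>c x. c \<in> A \<Longrightarrow> x \<in> snd c ` fst c \<Longrightarrow> vf_rep c X x = V c x"
  shows "smooth_vf A X"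
  unfolding smooth_vf_iff using assms smooth_on_cong[OF open_chart_image] by metis

lemma smooth_vf_add:
  assumes "smooth_vf A X" "smooth_vf A Y" shows "smooth_vf A (\<lambda>p. X p + Y p)"
proof (rule smooth_vfI[where V="\<lambda>c x. vf_rep c X x + vf_rep c Y x"])
  fix c assume c: "c \<in> A"
  show "smooth_on (snd c ` fst c) (\<lambda>x. vf_rep c X x + vf_rep c Y x)"
    by (rule smooth_on_add[OF open_chart_image[OF c] assms(1)[THEN smooth_vf_rep[OF _ c]] assms(2)[THEN smooth_vf_rep[OF _ c]]])
  fix x assume "x \<in> snd c ` fst c"
  then show "vf_rep c (\<lambda>p. X p + Y p) x = vf_rep c X x + vf_rep c Y x"
    using linear_add[OF linear_tangent_coord[OF c chart_inv_mem[OF c]]] by (simp add: vf_rep_def)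
qed

lemma smooth_vf_scaleR:
  assumes "smooth_fun A f" "smooth_vf A X" shows "smooth_vf A (\<lambda>p. f p *\<^sub>R X p)"
proof (rule smooth_vfI[where V="\<lambda>c x. (f \<circ> chart_inv c) x *\<^sub>R vf_rep c X x"])
  fix c assume c: "c \<in> A"
  show "smooth_on (snd c ` fst c) (\<lambda>x. (f \<circ> chart_inv c) x *\<^sub>R vf_rep c X x)"
    by (rule smooth_on_scaleR[OF open_chart_image[OF c] assms(1)[THEN smooth_fun_rep[OF _ c]] assms(2)[THEN smooth_vf_rep[OF _ c]]])
  fix x assume "x \<in> snd c ` fst c"
  then show "vf_rep c (\<lambda>p. f p *\<^sub>R X p) x = (f \<circ> chart_inv c) x *\<^sub>R vf_rep c X x"
    using linear_cmul[OF linear_tangent_coord[OF c chart_inv_mem[OF c]]] by (simp add: vf_rep_def)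
qed

lemma smooth_fun_const: "smooth_fun A (\<lambda>p. a)"
  by (simp add: smooth_fun_def comp_def smooth_on_const)

lemma smooth_fun_mult:
  assumes "smooth_fun A f" "smooth_fun A g" shows "smooth_fun A (\<lambda>p. f p * g p)"
  using assms by (simp add: smooth_fun_def comp_def smooth_on_mult open_chart_image)

lemma smooth_fun_diff:
  assumes "smooth_fun A f" "smooth_fun A g" shows "smooth_fun A (\<lambda>p. f p - g p)"
  using assms by (simp add: smooth_fun_def comp_def smooth_on_diff open_chart_image)

lemma smooth_vf_0: "smooth_vf A (\<lambda>p. 0)"
proof (rule smooth_vfI[where V="\<lambda>c x. 0"])
  fix c x assume c: "c \<in> A" and "x \<in> snd c ` fst c"
  then show "vf_rep c (\<lambda>p. 0) x = 0"
    using linear_0[OF linear_tangent_coord[OF c chart_inv_mem[OF c]]] by (simp add: vf_rep_def)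
qed (rule smooth_on_const)

lemma smooth_vf_uminus:
  assumes "smooth_vf A X" shows "smooth_vf A (\<lambda>p. - X p)"
  using smooth_vf_scaleR[OF smooth_fun_const[of "-1"] assms] by simp

lemma smooth_vf_diff:
  assumes "smooth_vf A X" "smooth_vf A Y" shows "smooth_vf A (\<lambda>p. X p - Y p)"
  using smooth_vf_add[OF assms(1) smooth_vf_uminus[OF assms(2)]] by simp

lemma smooth_vf_sum:
  "(\<And>i. i \<in> I \<Longrightarrow> smooth_vf A (X i)) \<Longrightarrow> smooth_vf A (\<lambda>p. \<Sum>i\<in>I. X i p)"
  by (induction I rule: infinite_finite_induct) (auto intro: smooth_vf_0 smooth_vf_add)

subsection \<open>The derivation defined by a vector field\<close>

lemma smooth_fun_has_derivative:
  assumes "smooth_fun A f" "c \<in> A" "p \<in> fst c"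
  shows "((f \<circ> chart_inv c) has_derivative frechet_derivative (f \<circ> chart_inv c) (at (snd c p))) (at (snd c p))"
  by (rule smooth_on_has_derivative[OF smooth_fun_rep[OF assms(1,2)]]) (use assms in auto)

lemma vf_deriv_chart:
  assumes f: "smooth_fun A f" and c: "c \<in> A" "p \<in> fst c"
  shows "vf_deriv A X f p = frechet_derivative (f \<circ> chart_inv c) (at (snd c p)) (vf_rep c X (snd c p))"
  using frechet_derivative_at[OF derivative_change_chart[OF chart_at_mem c(1) mem_chart_at c(2)
      smooth_fun_has_derivative[OF f c]]]
  by (simp add: vf_deriv_def vf_rep_at[OF c] tangent_coord_eq fun_eq_iff)

lemma vf_deriv_comp_chart:
  assumes f: "smooth_fun A f" and c: "c \<in> A" "x \<in> snd c ` fst c"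
  shows "(vf_deriv A X f \<circ> chart_inv c) x = frechet_derivative (f \<circ> chart_inv c) (at x) (vf_rep c X x)"
  using vf_deriv_chart[OF f c(1) chart_inv_mem[OF c]] by (simp add: chart_inv_right[OF c])

lemma smooth_fun_vf_deriv:
  assumes "smooth_vf A X" "smooth_fun A f"
  shows "smooth_fun A (vf_deriv A X f)"
  unfolding smooth_fun_def
proof
  fix c assume c: "c \<in> A"
  show "smooth_on (snd c ` fst c) (vf_deriv A X f \<circ> chart_inv c)"
    by (rule smooth_on_cong[OF open_chart_image[OF c] vf_deriv_comp_chart[OF assms(2) c, symmetric]
          smooth_on_derivative[OF open_chart_image[OF c] smooth_fun_rep[OF assms(2) c] smooth_vf_rep[OF assms(1) c]]])
qed

lemma vf_deriv_has_derivative: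
  assumes "smooth_fun A f"
  shows "((f \<circ> chart_inv (chart_at A p)) has_derivative
    frechet_derivative (f \<circ> chart_inv (chart_at A p)) (at (snd (chart_at A p) p))) (at (snd (chart_at A p) p))"
  by (rule smooth_fun_has_derivative[OF assms chart_at_mem mem_chart_at])

lemma vf_deriv_add_fun:
  assumes "smooth_fun A f" "smooth_fun A g"
  shows "vf_deriv A X (\<lambda>p. f p + g p) p = vf_deriv A X f p + vf_deriv A X g p"
  using frechet_derivative_at[OF has_derivative_add[OF assms[THEN vf_deriv_has_derivative]], of p]
  by (simp add: vf_deriv_def comp_def fun_eq_iff)

lemma vf_deriv_diff_fun:
  assumes "smooth_fun A f" "smooth_fun A g"
  shows "vf_deriv A X (\<lambda>p. f p - g p) p = vf_deriv A X f p - vf_deriv A X g p"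
  using frechet_derivative_at[OF has_derivative_diff[OF assms[THEN vf_deriv_has_derivative]], of p]
  by (simp add: vf_deriv_def comp_def fun_eq_iff)

lemma vf_deriv_mult_fun:
  assumes "smooth_fun A f" "smooth_fun A g"
  shows "vf_deriv A X (\<lambda>p. f p * g p) p = f p * vf_deriv A X g p + vf_deriv A X f p * g p"
  using frechet_derivative_at[OF has_derivative_mult[OF assms[THEN vf_deriv_has_derivative]], of p]
  by (simp add: vf_deriv_def comp_def fun_eq_iff chart_inv_left[OF chart_at_mem mem_chart_at])

lemma vf_deriv_const: "vf_deriv A X (\<lambda>p. a) p = 0"
  by (simp add: vf_deriv_def comp_def)

lemma vf_deriv_linear:
  assumes "smooth_fun A f"
  shows "linear (frechet_derivative (f \<circ> chart_inv (chart_at A p)) (at (snd (chart_at A p) p)))"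
  using has_derivative_linear[OF vf_deriv_has_derivative[OF assms]] .

subsection \<open>Extending local objects by zero\<close>

text \<open>
  Every point lies in one of the two open sets \<open>fst c\<close>, where the function is smooth by assumption,
  and \<open>- K\<close>, where it is zero. The same argument works for vector fields.
\<close>

lemma smooth_fun_extend_by_zero:
  assumes c: "c \<in> A" and K: "closed K" "K \<subseteq> fst c" "\<And>q. q \<notin> K \<Longrightarrow> f q = 0"
    and f: "smooth_on (snd c ` fst c) (f \<circ> chart_inv c)"
  shows "smooth_fun A f"
  unfolding smooth_fun_def
proof (intro ballI smooth_on_local)
  fix d x assume d: "d \<in> A" and "x \<in> snd d ` fst d"
  then obtain q where q: "q \<in> fst d" "x = snd d q" by auto
  show "\<exists>U. open U \<and> x \<in> U \<and> smooth_on U (f \<circ> chart_inv d)"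
  proof (cases "q \<in> fst c")
    case True
    let ?U = "snd d ` (fst d \<inter> fst c)"
    have U: "open ?U" by (rule open_chart_image_Int[OF d open_chart_domain[OF c]])
    have "smooth_on ?U (\<lambda>x. (f \<circ> chart_inv c) ((snd c \<circ> chart_inv d) x))"
      by (rule smooth_on_compose[OF U open_chart_image[OF c] _ smooth_on_transition[OF d c] f])
         (auto simp: chart_inv_left[OF d])
    then have "smooth_on ?U (f \<circ> chart_inv d)"
      by (rule smooth_on_cong[OF U, rotated]) (auto simp: chart_inv_left c d)
    then show ?thesis using U True q by blast
  next
    case False
    let ?U = "snd d ` (fst d \<inter> - K)"
    have U: "open ?U" by (rule open_chart_image_Int[OF d]) (use K in auto)
    have "smooth_on ?U (f \<circ> chart_inv d)"
      by (rule smooth_on_cong[OF U _ smooth_on_const[of _ 0]]) (auto simp: chart_inv_left d K(3))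
    moreover have "x \<in> ?U" using False q K by auto
    ultimately show ?thesis using U by blast
  qed
qed

lemma smooth_vf_extend_by_zero:
  assumes c: "c \<in> A" and K: "closed K" "K \<subseteq> fst c" "\<And>q. q \<notin> K \<Longrightarrow> X q = 0"
    and X: "smooth_on (snd c ` fst c) (vf_rep c X)"
  shows "smooth_vf A X"
  unfolding smooth_vf_iff
proof (intro ballI smooth_on_local)
  fix d x assume d: "d \<in> A" and "x \<in> snd d ` fst d"
  then obtain q where q: "q \<in> fst d" "x = snd d q" by auto
  show "\<exists>U. open U \<and> x \<in> U \<and> smooth_on U (vf_rep d X)"
  proof (cases "q \<in> fst c")
    case True
    let ?U = "snd d ` (fst d \<inter> fst c)" and ?W = "snd c ` (fst c \<inter> fst d)"
    let ?G = "\<lambda>y. frechet_derivative (snd d \<circ> chart_inv c) (at y) (vf_rep c X y)"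
    have U: "open ?U" by (rule open_chart_image_Int[OF d open_chart_domain[OF c]])
    have W: "open ?W" by (rule open_chart_image_Int[OF c open_chart_domain[OF d]])
    have G: "smooth_on ?W ?G"
      by (rule smooth_on_derivative[OF W smooth_on_transition[OF c d] smooth_on_subset[OF X]]) auto
    have "smooth_on ?U (\<lambda>x. ?G ((snd c \<circ> chart_inv d) x))"
      by (rule smooth_on_compose[OF U W _ smooth_on_transition[OF d c] G])
         (auto simp: chart_inv_left[OF d])
    then have "smooth_on ?U (vf_rep d X)"
      by (rule smooth_on_cong[OF U, rotated])
         (auto simp: chart_inv_left c d vf_rep_change[OF c d] chart_jacobian_def)
    then show ?thesis using U True q by blast
  next
    case False
    let ?U = "snd d ` (fst d \<inter> - K)"
    have U: "open ?U" by (rule open_chart_image_Int[OF d]) (use K in auto)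
    have "smooth_on ?U (vf_rep d X)"
      by (rule smooth_on_cong[OF U _ smooth_on_const[of _ 0]])
         (auto simp: vf_rep_at d K(3) linear_0[OF linear_tangent_coord])
    moreover have "x \<in> ?U" using False q K by auto
    ultimately show ?thesis using U by blast
  qed
qed

text \<open>
  The support of a bump function in coordinates is compact, hence so is its preimage \<open>K\<close> in the
  manifold; that \<open>K\<close> is closed is where the Hausdorff property enters.
\<close>

lemma chart_bump:
  assumes c: "c \<in> A" and p: "p \<in> fst c"
  obtains h :: "'e \<Rightarrow> real" and K where "smooth_on UNIV h" "h (snd c p) = 1" "closed K" "K \<subseteq> fst c"
    "\<And>q. q \<in> fst c \<Longrightarrow> q \<notin> K \<Longrightarrow> h (snd c q) = 0"
proof -
  have "snd c p \<in> snd c ` fst c" using p by auto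
  from bump_function[OF open_chart_image[OF c] this] obtain h :: "'e \<Rightarrow> real" and r
    where h: "smooth_on UNIV h" "h (snd c p) = 1" "cball (snd c p) r \<subseteq> snd c ` fst c"
      "\<And>y. y \<notin> cball (snd c p) r \<Longrightarrow> h y = 0" by metis
  define K where "K = chart_inv c ` cball (snd c p) r"
  have "compact K" unfolding K_def
    by (rule compact_continuous_image[OF continuous_on_subset[OF continuous_on_chart_inv[OF c] h(3)]]) simp
  then have "closed K" by (rule compact_imp_closed)
  moreover have "K \<subseteq> fst c" using h(3) chart_inv_mem[OF c] by (auto simp: K_def)
  moreover have "h (snd c q) = 0" if "q \<in> fst c" "q \<notin> K" for q
  proof (rule h(4))
    show "snd c q \<notin> cball (snd c p) r"
      using that chart_inv_left[OF c, of q] unfolding K_def by (metis image_eqI)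
  qed
  ultimately show thesis using that h by blast
qed

text \<open>
  Functions and vector fields given in the coordinates of \<open>c\<close>, multiplied by the bump function \<open>h\<close>
  and extended by zero.
\<close>

definition cut_fun :: "('m, 'e) chart \<Rightarrow> ('e \<Rightarrow> real) \<Rightarrow> ('e \<Rightarrow> real) \<Rightarrow> 'm \<Rightarrow> real" where
  "cut_fun c h F q = (if q \<in> fst c then h (snd c q) * F (snd c q) else 0)"

definition cut_vf :: "('m, 'e) chart \<Rightarrow> ('e \<Rightarrow> real) \<Rightarrow> ('e \<Rightarrow> 'e) \<Rightarrow> 'm \<Rightarrow> 'e" where
  "cut_vf c h V q = (if q \<in> fst c then tangent_vec c q (h (snd c q) *\<^sub>R V (snd c q)) else 0)"

context
  fixes c :: "('m, 'e) chart" and h :: "'e \<Rightarrow> real" and K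
  assumes c: "c \<in> A" and h: "smooth_on UNIV h" and K: "closed K" "K \<subseteq> fst c"
    "\<And>q. q \<in> fst c \<Longrightarrow> q \<notin> K \<Longrightarrow> h (snd c q) = 0"
begin

lemma smooth_fun_cut:
  assumes F: "smooth_on (snd c ` fst c) F"
  shows "smooth_fun A (cut_fun c h F)"
proof (rule smooth_fun_extend_by_zero[OF c K(1,2)])
  show "cut_fun c h F q = 0" if "q \<notin> K" for q using K(3) that by (simp add: cut_fun_def)
  have "smooth_on (snd c ` fst c) (\<lambda>x. h x * F x)"
    by (rule smooth_on_mult[OF open_chart_image[OF c] smooth_on_subset[OF h subset_UNIV] F])
  then show "smooth_on (snd c ` fst c) (cut_fun c h F \<circ> chart_inv c)"
    by (rule smooth_on_cong[OF open_chart_image[OF c], rotated]) (auto simp: cut_fun_def chart_inv_left c)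
qed

lemma smooth_vf_cut:
  assumes V: "smooth_on (snd c ` fst c) V"
  shows "smooth_vf A (cut_vf c h V)"
proof (rule smooth_vf_extend_by_zero[OF c K(1,2)])
  show "cut_vf c h V q = 0" if "q \<notin> K" for q
    using K(3) that linear_0[OF linear_tangent_vec[OF c]] by (auto simp: cut_vf_def)
  have "smooth_on (snd c ` fst c) (\<lambda>x. h x *\<^sub>R V x)"
    by (rule smooth_on_scaleR[OF open_chart_image[OF c] smooth_on_subset[OF h subset_UNIV] V])
  then show "smooth_on (snd c ` fst c) (vf_rep c (cut_vf c h V))"
    by (rule smooth_on_cong[OF open_chart_image[OF c], rotated])
       (auto simp: cut_vf_def vf_rep_at tangent_coord_vec c)
qed

end

lemma smooth_vf_extension: "\<exists>X. smooth_vf A X \<and> X p = v"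
proof -
  let ?c = "chart_at A p"
  obtain h :: "'e \<Rightarrow> real" and K where h: "smooth_on UNIV h" "h (snd ?c p) = 1" "closed K" "K \<subseteq> fst ?c"
    "\<And>q. q \<in> fst ?c \<Longrightarrow> q \<notin> K \<Longrightarrow> h (snd ?c q) = 0"
    using chart_bump[OF chart_at_mem mem_chart_at, of p] by metis
  let ?X = "cut_vf ?c h (\<lambda>x. tangent_coord A ?c p v)"
  have "smooth_vf A ?X" by (rule smooth_vf_cut[OF chart_at_mem h(1,3-5) smooth_on_const])
  moreover have "?X p = v"
    by (simp add: cut_vf_def mem_chart_at h(2) tangent_vec_coord chart_at_mem)
  ultimately show ?thesis by blast
qed

text \<open>
  The coordinate functions, cut off by a bump function and normalised to vanish at \<open>p\<close>, recover the
  components of a tangent vector from its action on smooth functions.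
\<close>

lemma tangent_vector_eqI:
  assumes "\<And>f. smooth_fun A f \<Longrightarrow> vf_deriv A X f p = vf_deriv A Y f p"
  shows "X p = Y p"
proof -
  let ?c = "chart_at A p"
  note c = chart_at_mem[of p] mem_chart_at[of p]
  obtain h :: "'e \<Rightarrow> real" and K where h: "smooth_on UNIV h" "h (snd ?c p) = 1" "closed K" "K \<subseteq> fst ?c"
    "\<And>q. q \<in> fst ?c \<Longrightarrow> q \<notin> K \<Longrightarrow> h (snd ?c q) = 0"
    using chart_bump[OF c] by metis
  have "vf_rep ?c X (snd ?c p) \<bullet> b = vf_rep ?c Y (snd ?c p) \<bullet> b" for b
  proof -
    let ?F = "\<lambda>x. (x - snd ?c p) \<bullet> b"
    let ?f = "cut_fun ?c h ?F"
    have f: "smooth_fun A ?f"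
      by (intro smooth_fun_cut[OF c(1) h(1,3-5)] smooth_on_inner smooth_on_diff smooth_on_id smooth_on_const
          open_chart_image c(1))
    have 1: "((\<lambda>x. h x * ?F x) has_derivative (\<lambda>v. h (snd ?c p) * (v \<bullet> b)
        + frechet_derivative h (at (snd ?c p)) v * ?F (snd ?c p))) (at (snd ?c p))"
      by (intro has_derivative_mult smooth_on_has_derivative[OF h(1)] UNIV_I has_derivative_inner_left)
         (auto intro!: derivative_eq_intros)
    have 2: "((?f \<circ> chart_inv ?c) has_derivative (\<lambda>v. h (snd ?c p) * (v \<bullet> b)
        + frechet_derivative h (at (snd ?c p)) v * ?F (snd ?c p))) (at (snd ?c p))"
      by (rule has_derivative_transform_within_open[OF 1 open_chart_image[OF c(1)]])
         (auto simp: cut_fun_def chart_inv_left c)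
    have "vf_deriv A Z ?f p = vf_rep ?c Z (snd ?c p) \<bullet> b" for Z
      unfolding vf_deriv_chart[OF f c] using h(2) by (simp add: frechet_derivative_at[OF 2, symmetric])
    with assms[OF f] show ?thesis by simp
  qed
  then have "vf_rep ?c X (snd ?c p) = vf_rep ?c Y (snd ?c p)" by (rule euclidean_eqI)
  then have "tangent_coord A ?c p (X p) = tangent_coord A ?c p (Y p)" by (simp add: vf_rep_at c)
  then show ?thesis by (metis tangent_vec_coord c)
qed

text \<open>
  With a bump function \<open>k\<close>, \<open>X = k\<^sup>2 X + (1 - k\<^sup>2) X\<close>. In the first part one factor \<open>k\<close> cuts off the
  components of \<open>X\<close> and the other the coordinate frame, so that both become global. All coefficients
  vanish at \<open>p\<close> because \<open>X p = 0\<close> and \<open>k p = 1\<close>.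
\<close>

lemma vf_decomposition:
  assumes X: "smooth_vf A X" and Xp: "X p = 0"
  shows "\<exists>f E u. (\<forall>b::'e. smooth_fun A (f b)) \<and> (\<forall>b. smooth_vf A (E b)) \<and> smooth_fun A u \<and>
    (\<forall>b. f b p = 0) \<and> u p = 0 \<and> X = (\<lambda>q. (\<Sum>b\<in>Basis. f b q *\<^sub>R E b q) + u q *\<^sub>R X q)"
proof -
  let ?c = "chart_at A p"
  note c = chart_at_mem[of p] mem_chart_at[of p]
  obtain h :: "'e \<Rightarrow> real" and K where h: "smooth_on UNIV h" "h (snd ?c p) = 1" "closed K" "K \<subseteq> fst ?c"
    "\<And>q. q \<in> fst ?c \<Longrightarrow> q \<notin> K \<Longrightarrow> h (snd ?c q) = 0"
    using chart_bump[OF c] by metis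
  define f where "f b = cut_fun ?c h (\<lambda>x. vf_rep ?c X x \<bullet> b)" for b
  define E where "E b = cut_vf ?c h (\<lambda>x. b)" for b
  define k where "k = cut_fun ?c h (\<lambda>x. 1)"
  define u where "u q = 1 - k q * k q" for q
  have "smooth_fun A (f b)" for b unfolding f_def
    by (intro smooth_fun_cut[OF c(1) h(1,3-5)] smooth_on_inner smooth_vf_rep[OF X c(1)] smooth_on_const
          open_chart_image c(1))
  moreover have "smooth_vf A (E b)" for b unfolding E_def
    by (intro smooth_vf_cut[OF c(1) h(1,3-5)] smooth_on_const)
  moreover have "smooth_fun A k" unfolding k_def
    by (intro smooth_fun_cut[OF c(1) h(1,3-5)] smooth_on_const)
  then have "smooth_fun A u" unfolding u_def
    by (intro smooth_fun_diff smooth_fun_const smooth_fun_mult)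
  moreover have "f b p = 0" for b
    by (simp add: f_def cut_fun_def vf_rep_at c Xp linear_0[OF linear_tangent_coord[OF c]])
  moreover have "u p = 0" by (simp add: u_def k_def cut_fun_def c h)
  moreover have "X q = (\<Sum>b\<in>Basis. f b q *\<^sub>R E b q) + u q *\<^sub>R X q" for q
  proof (cases "q \<in> fst ?c")
    case True
    let ?x = "snd ?c q"
    note l = linear_tangent_vec[OF c(1) True]
    have "(\<Sum>b\<in>Basis. f b q *\<^sub>R E b q) =
      (h ?x * h ?x) *\<^sub>R (\<Sum>b\<in>Basis. (vf_rep ?c X ?x \<bullet> b) *\<^sub>R tangent_vec ?c q b)"
      using True by (simp add: f_def E_def cut_fun_def cut_vf_def linear_cmul[OF l] scaleR_sum_right algebra_simps)
    also have "(\<Sum>b\<in>Basis. (vf_rep ?c X ?x \<bullet> b) *\<^sub>R tangent_vec ?c q b) =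
       tangent_vec ?c q (\<Sum>b\<in>Basis. (vf_rep ?c X ?x \<bullet> b) *\<^sub>R b)"
      by (simp add: linear_sum[OF l] linear_cmul[OF l])
    also have "\<dots> = X q"
      by (simp add: euclidean_representation vf_rep_at c(1) True tangent_vec_coord)
    finally show ?thesis using True by (simp add: u_def k_def cut_fun_def algebra_simps)
  next
    case False
    then show ?thesis by (simp add: u_def k_def f_def cut_fun_def)
  qed
  then have "X = (\<lambda>q. (\<Sum>b\<in>Basis. f b q *\<^sub>R E b q) + u q *\<^sub>R X q)" by blast
  ultimately show ?thesis by (intro exI[of _ f] exI[of _ E] exI[of _ u]) simp
qed

text \<open>
  By \<open>vf_decomposition\<close> the difference of \<open>X\<close> and \<open>Y\<close> is a combination of smooth vector fields whose
  coefficients vanish at \<open>p\<close>, and the coefficients come out of \<open>T\<close> with their values at \<open>p\<close>.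
\<close>

lemma tensorial:
  fixes T :: "('m \<Rightarrow> 'e) \<Rightarrow> 'b::real_vector"
  assumes add: "\<And>X Y. smooth_vf A X \<Longrightarrow> smooth_vf A Y \<Longrightarrow> T (\<lambda>q. X q + Y q) = T X + T Y"
    and scale: "\<And>f X. smooth_fun A f \<Longrightarrow> smooth_vf A X \<Longrightarrow> T (\<lambda>q. f q *\<^sub>R X q) = f p *\<^sub>R T X"
    and X: "smooth_vf A X" and Y: "smooth_vf A Y" and eq: "X p = Y p"
  shows "T X = T Y"
proof -
  have zero: "T (\<lambda>q. 0) = 0" using scale[OF smooth_fun_const[of 0] X] by simp
  have sum: "T (\<lambda>q. \<Sum>b\<in>B. F b q) = (\<Sum>b\<in>B. T (F b))" if "\<And>b. smooth_vf A (F b)"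
    for F :: "'e \<Rightarrow> 'm \<Rightarrow> 'e" and B
    by (induction B rule: infinite_finite_induct) (auto simp: zero add smooth_vf_sum that)
  let ?Z = "\<lambda>q. X q + (-1) *\<^sub>R Y q"
  have Z: "smooth_vf A ?Z" by (intro smooth_vf_add X smooth_vf_scaleR smooth_fun_const Y)
  have Zp: "?Z p = 0" using eq by simp
  obtain f :: "'e \<Rightarrow> 'm \<Rightarrow> real" and E and u where "(\<forall>b. smooth_fun A (f b)) \<and> (\<forall>b. smooth_vf A (E b)) \<and>
      smooth_fun A u \<and> (\<forall>b. f b p = 0) \<and> u p = 0 \<and>
      ?Z = (\<lambda>q. (\<Sum>b\<in>Basis. f b q *\<^sub>R E b q) + u q *\<^sub>R ?Z q)"
    using vf_decomposition[OF Z Zp] by (elim exE) (rule that, assumption)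
  then have d: "\<And>b. smooth_fun A (f b)" "\<And>b. smooth_vf A (E b)" "smooth_fun A u"
    "\<And>b. f b p = 0" "u p = 0" "?Z = (\<lambda>q. (\<Sum>b\<in>Basis. f b q *\<^sub>R E b q) + u q *\<^sub>R ?Z q)"
    by blast+
  have "T ?Z = T (\<lambda>q. (\<Sum>b\<in>Basis. f b q *\<^sub>R E b q) + u q *\<^sub>R ?Z q)"
    by (rule arg_cong[OF d(6)])
  also have "\<dots> = T (\<lambda>q. \<Sum>b\<in>Basis. f b q *\<^sub>R E b q) + T (\<lambda>q. u q *\<^sub>R ?Z q)"
    by (rule add) (intro smooth_vf_sum smooth_vf_scaleR d Z)+
  also have "\<dots> = 0"
    using scale[OF d(3) Z] by (simp add: sum smooth_vf_scaleR d(1-5) scale)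
  finally have "T ?Z = 0" .
  moreover have "T ?Z = T X + (-1) *\<^sub>R T Y"
    using add[OF X smooth_vf_scaleR[OF smooth_fun_const Y], of "-1"] scale[OF smooth_fun_const Y, of "-1"]
    by simp
  ultimately show ?thesis by simp
qed

subsection \<open>The Lie bracket\<close>

text \<open>The coordinate expression of the Lie bracket.\<close>

definition bracket_rep :: "('m, 'e) chart \<Rightarrow> ('m \<Rightarrow> 'e) \<Rightarrow> ('m \<Rightarrow> 'e) \<Rightarrow> 'e \<Rightarrow> 'e" where
  "bracket_rep c X Y x = frechet_derivative (vf_rep c Y) (at x) (vf_rep c X x)
     - frechet_derivative (vf_rep c X) (at x) (vf_rep c Y x)"

text \<open>
  Each half of the coordinate expression transforms like a vector up to a second derivative of the
  coordinate change; that term is symmetric in the two vector fields and cancels.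
\<close>

lemma bracket_rep_change:
  assumes X: "smooth_vf A X" and Y: "smooth_vf A Y"
    and c: "c \<in> A" and d: "d \<in> A" and p: "p \<in> fst c" "p \<in> fst d"
  shows "bracket_rep d X Y (snd d p) = chart_jacobian c d p (bracket_rep c X Y (snd c p))"
proof -
  let ?\<tau> = "snd d \<circ> chart_inv c" and ?x = "snd c p" and ?W = "snd c ` (fst c \<inter> fst d)"
  let ?D = "frechet_derivative ?\<tau>"
  have W: "open ?W" by (rule open_chart_image_Int[OF c open_chart_domain[OF d]])
  have x: "?x \<in> ?W" using p by auto
  have \<tau>: "smooth_on ?W ?\<tau>" by (rule smooth_on_transition[OF c d])
  have half: "frechet_derivative (vf_rep d Z) (at (snd d p)) (vf_rep d V (snd d p)) =
      frechet_derivative (\<lambda>y. ?D (at y) (vf_rep c Z ?x)) (at ?x) (vf_rep c V ?x)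
      + ?D (at ?x) (frechet_derivative (vf_rep c Z) (at ?x) (vf_rep c V ?x))"
    if Z: "smooth_vf A Z" for Z V
  proof -
    have Zc: "smooth_on ?W (vf_rep c Z)" by (rule smooth_on_subset[OF smooth_vf_rep[OF Z c]]) auto
    have 1: "((\<lambda>y. ?D (at y) (vf_rep c Z y)) has_derivative
       (\<lambda>u. frechet_derivative (\<lambda>y. ?D (at y) (vf_rep c Z ?x)) (at ?x) u
        + ?D (at ?x) (frechet_derivative (vf_rep c Z) (at ?x) u))) (at ?x)"
      by (rule has_derivative_frechet_derivative_along[OF W \<tau> Zc x])
    have "((vf_rep d Z) has_derivative frechet_derivative (vf_rep d Z) (at (snd d p))) (at (snd d p))"
      by (rule smooth_on_has_derivative[OF smooth_vf_rep[OF Z d]]) (use p in auto)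
    then have "((vf_rep d Z) has_derivative frechet_derivative (vf_rep d Z) (at (snd d p))) (at (?\<tau> ?x))"
      using p c by (simp add: chart_inv_left)
    from has_derivative_compose[OF transition_has_derivative[OF c d p] this]
    have 2: "((\<lambda>y. vf_rep d Z (?\<tau> y)) has_derivative
       (\<lambda>u. frechet_derivative (vf_rep d Z) (at (snd d p)) (chart_jacobian c d p u))) (at ?x)" .
    have 3: "((\<lambda>y. ?D (at y) (vf_rep c Z y)) has_derivative
       (\<lambda>u. frechet_derivative (vf_rep d Z) (at (snd d p)) (chart_jacobian c d p u))) (at ?x)"
      by (rule has_derivative_transform_within_open[OF 2 W x])
         (auto simp: chart_inv_left c vf_rep_change[OF c d] chart_jacobian_def)
    show ?thesis
      using fun_cong[OF has_derivative_unique[OF 3 1], of "vf_rep c V ?x"]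
      by (simp add: vf_rep_change[OF c d p])
  qed
  have sym: "frechet_derivative (\<lambda>y. ?D (at y) (vf_rep c Y ?x)) (at ?x) (vf_rep c X ?x) =
        frechet_derivative (\<lambda>y. ?D (at y) (vf_rep c X ?x)) (at ?x) (vf_rep c Y ?x)"
    by (rule second_derivative_symmetric[OF W x \<tau>])
  show ?thesis
    unfolding bracket_rep_def half[OF X] half[OF Y] sym
    by (simp add: linear_diff[OF linear_chart_jacobian[OF c d p]] chart_jacobian_def[symmetric])
qed

text \<open>
  The coordinate expressions fit together to a global vector field by \<open>bracket_rep_change\<close>. In the
  commutator of the two derivations the second derivatives of \<open>f\<close> cancel by symmetry.
\<close>

lemma lie_bracket_exists:
  assumes X: "smooth_vf A X" and Y: "smooth_vf A Y"
  shows "\<exists>Z. smooth_vf A Z \<and> (\<forall>f. smooth_fun A f \<longrightarrow> (\<forall>p. vf_deriv A Z f p =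
             vf_deriv A X (vf_deriv A Y f) p - vf_deriv A Y (vf_deriv A X f) p))"
proof -
  define Z where "Z p = bracket_rep (chart_at A p) X Y (snd (chart_at A p) p)" for p
  have rep: "vf_rep d Z (snd d p) = bracket_rep d X Y (snd d p)" if d: "d \<in> A" "p \<in> fst d" for d p
    using bracket_rep_change[OF X Y chart_at_mem d(1) mem_chart_at d(2)]
    by (simp add: vf_rep_at[OF d] tangent_coord_eq Z_def)
  have "smooth_vf A Z"
  proof (rule smooth_vfI[where V="\<lambda>c. bracket_rep c X Y"])
    fix c assume c: "c \<in> A"
    note s = open_chart_image[OF c] smooth_vf_rep[OF X c] smooth_vf_rep[OF Y c]
    show "smooth_on (snd c ` fst c) (bracket_rep c X Y)"
      unfolding bracket_rep_def[abs_def] by (intro smooth_on_diff smooth_on_derivative s)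
    show "vf_rep c Z x = bracket_rep c X Y x" if "x \<in> snd c ` fst c" for x
      using that rep[OF c] by auto
  qed
  moreover have "vf_deriv A Z f p = vf_deriv A X (vf_deriv A Y f) p - vf_deriv A Y (vf_deriv A X f) p"
    if f: "smooth_fun A f" for f p
  proof -
    let ?c = "chart_at A p" and ?x = "snd (chart_at A p) p"
    note c = chart_at_mem[of p] mem_chart_at[of p]
    let ?f = "f \<circ> chart_inv ?c" and ?S = "snd ?c ` fst ?c"
    have x: "?x \<in> ?S" using c by auto
    have fs: "smooth_on ?S ?f" by (rule smooth_fun_rep[OF f c(1)])
    have half: "vf_deriv A V (vf_deriv A U f) p =
        frechet_derivative (\<lambda>y. frechet_derivative ?f (at y) (vf_rep ?c U ?x)) (at ?x) (vf_rep ?c V ?x)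
        + frechet_derivative ?f (at ?x) (frechet_derivative (vf_rep ?c U) (at ?x) (vf_rep ?c V ?x))"
      if U: "smooth_vf A U" for U V
    proof -
      have "((vf_deriv A U f \<circ> chart_inv ?c) has_derivative
        (\<lambda>u. frechet_derivative (\<lambda>y. frechet_derivative ?f (at y) (vf_rep ?c U ?x)) (at ?x) u
          + frechet_derivative ?f (at ?x) (frechet_derivative (vf_rep ?c U) (at ?x) u))) (at ?x)"
        by (rule has_derivative_transform_within_open[OF has_derivative_frechet_derivative_along[OF
              open_chart_image[OF c(1)] fs smooth_vf_rep[OF U c(1)] x] open_chart_image[OF c(1)] x])
           (rule vf_deriv_comp_chart[OF f c(1), symmetric])
      from fun_cong[OF frechet_derivative_at[OF this], of "vf_rep ?c V ?x"] show ?thesis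
        unfolding vf_deriv_chart[OF smooth_fun_vf_deriv[OF U f] c] by (rule sym)
    qed
    have sym: "frechet_derivative (\<lambda>y. frechet_derivative ?f (at y) (vf_rep ?c Y ?x)) (at ?x) (vf_rep ?c X ?x) =
        frechet_derivative (\<lambda>y. frechet_derivative ?f (at y) (vf_rep ?c X ?x)) (at ?x) (vf_rep ?c Y ?x)"
      by (rule second_derivative_symmetric[OF open_chart_image[OF c(1)] x fs])
    show ?thesis
      unfolding half[OF X] half[OF Y] sym vf_deriv_chart[OF f c] rep[OF c] bracket_rep_def
      by (simp add: linear_diff[OF smooth_on_linear_derivative[OF fs x]])
  qed
  ultimately show ?thesis by blast
qed

lemma
  assumes X: "smooth_vf A X" and Y: "smooth_vf A Y"
  shows smooth_vf_lie_bracket: "smooth_vf A (lie_bracket A X Y)"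
    and vf_deriv_lie_bracket: "smooth_fun A f \<Longrightarrow> vf_deriv A (lie_bracket A X Y) f p =
             vf_deriv A X (vf_deriv A Y f) p - vf_deriv A Y (vf_deriv A X f) p"
proof -
  let ?P = "\<lambda>Z. smooth_vf A Z \<and> (\<forall>f. smooth_fun A f \<longrightarrow> (\<forall>p. vf_deriv A Z f p =
             vf_deriv A X (vf_deriv A Y f) p - vf_deriv A Y (vf_deriv A X f) p))"
  have "\<exists>!Z. ?P Z"
  proof (rule ex_ex1I[OF lie_bracket_exists[OF X Y]])
    fix Z Z' assume Z: "?P Z" "?P Z'"
    show "Z = Z'"
    proof
      fix p show "Z p = Z' p" by (rule tangent_vector_eqI) (use Z in simp)
    qed
  qed
  from theI'[OF this] have "?P (lie_bracket A X Y)" unfolding lie_bracket_def .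
  then show "smooth_vf A (lie_bracket A X Y)"
    "smooth_fun A f \<Longrightarrow> vf_deriv A (lie_bracket A X Y) f p =
             vf_deriv A X (vf_deriv A Y f) p - vf_deriv A Y (vf_deriv A X f) p" by blast+
qed

end

section \<open>Traces and algebraic curvature tensors\<close>

definition lin_trace :: "('a::euclidean_space \<Rightarrow> 'a) \<Rightarrow> real" where
  "lin_trace f = (\<Sum>b\<in>Basis. f b \<bullet> b)"

definition ric_of :: "('a::euclidean_space \<Rightarrow> 'a \<Rightarrow> 'a \<Rightarrow> 'a) \<Rightarrow> 'a \<Rightarrow> 'a \<Rightarrow> real" where
  "ric_of F v w = lin_trace (\<lambda>u. F u v w)"

definition ricop_of :: "('a \<Rightarrow> 'a \<Rightarrow> real) \<Rightarrow> ('a::euclidean_space \<Rightarrow> 'a \<Rightarrow> 'a \<Rightarrow> 'a) \<Rightarrow> 'a \<Rightarrow> 'a" where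
  "ricop_of g F u = (THE w. \<forall>v. g w v = ric_of F u v)"

text \<open>The curvature tensor of a space of constant curvature one.\<close>

definition const_curv :: "('a \<Rightarrow> 'a \<Rightarrow> real) \<Rightarrow> 'a::real_vector \<Rightarrow> 'a \<Rightarrow> 'a \<Rightarrow> 'a" where
  "const_curv g u v w = g v w *\<^sub>R u - g u w *\<^sub>R v"

text \<open>
  The conformal tensor of a tensor \<open>F\<close> in place of the curvature tensor. Its coefficients are those of
  the dimension \<open>2 * n + 1\<close>.
\<close>

definition weyl_of :: "nat \<Rightarrow> ('a \<Rightarrow> 'a \<Rightarrow> real) \<Rightarrow> ('a::euclidean_space \<Rightarrow> 'a \<Rightarrow> 'a \<Rightarrow> 'a) \<Rightarrow> 'a \<Rightarrow> 'a \<Rightarrow> 'a \<Rightarrow> 'a" where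
  "weyl_of n g F u v w = F u v w
     - (1 / (2 * real n - 1)) *\<^sub>R (ric_of F v w *\<^sub>R u + g v w *\<^sub>R ricop_of g F u
          - ric_of F u w *\<^sub>R v - g u w *\<^sub>R ricop_of g F v)
     + (lin_trace (ricop_of g F) / (2 * real n * (2 * real n - 1))) *\<^sub>R const_curv g u v w"

definition trilinear :: "('a::real_vector \<Rightarrow> 'a \<Rightarrow> 'a \<Rightarrow> 'a) \<Rightarrow> bool" where
  "trilinear F \<longleftrightarrow> (\<forall>v w. linear (\<lambda>u. F u v w)) \<and> (\<forall>u w. linear (\<lambda>v. F u v w)) \<and> (\<forall>u v. linear (F u v))"

lemma lin_trace_add: "lin_trace (\<lambda>u. f u + h u) = lin_trace f + lin_trace h"
  by (simp add: lin_trace_def inner_add_left sum.distrib)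

lemma lin_trace_diff: "lin_trace (\<lambda>u. f u - h u) = lin_trace f - lin_trace h"
  by (simp add: lin_trace_def inner_diff_left sum_subtractf)

lemma lin_trace_scaleR: "lin_trace (\<lambda>u. a *\<^sub>R f u) = a * lin_trace f"
  by (simp add: lin_trace_def sum_distrib_left)

lemma lin_trace_id: "lin_trace (\<lambda>u::'a::euclidean_space. u) = real DIM('a)"
  by (simp add: lin_trace_def)

lemma lin_trace_zero: "lin_trace (\<lambda>u. 0) = 0"
  by (simp add: lin_trace_def)

lemma lin_trace_rank_one:
  assumes "linear a" shows "lin_trace (\<lambda>u. a u *\<^sub>R x) = a x"
proof -
  have "a x = a (\<Sum>b\<in>Basis. (x \<bullet> b) *\<^sub>R b)" by (simp add: euclidean_representation)
  also have "\<dots> = (\<Sum>b\<in>Basis. (x \<bullet> b) * a b)" by (simp add: linear_sum[OF assms] linear_cmul[OF assms])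
  finally show ?thesis by (simp add: lin_trace_def mult.commute)
qed

lemma linear_lin_trace:
  assumes "\<And>u. linear (\<lambda>v. f v u)" shows "linear (\<lambda>v. lin_trace (f v))"
  unfolding lin_trace_def
  by (intro linear_compose_sum ballI linearI)
     (simp_all add: linear_add[OF assms] linear_cmul[OF assms] inner_add_left)

locale nondegenerate_form =
  fixes g :: "'a::euclidean_space \<Rightarrow> 'a \<Rightarrow> real"
  assumes bil: "bilinear g" and sym: "g u v = g v u" and nondeg: "(\<And>v. g u v = 0) \<Longrightarrow> u = 0"
begin

lemmas g_add = bilinear_ladd[OF bil] bilinear_radd[OF bil]
lemmas g_scale = bilinear_lmul[OF bil, unfolded real_scaleR_def] bilinear_rmul[OF bil, unfolded real_scaleR_def]
lemmas g_minus = bilinear_lneg[OF bil] bilinear_rneg[OF bil]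
lemmas g_diff = bilinear_lsub[OF bil] bilinear_rsub[OF bil]
lemmas g_zero = bilinear_lzero[OF bil] bilinear_rzero[OF bil]
lemmas g_simps = g_add g_scale g_minus g_diff g_zero

lemma linear_left: "linear (\<lambda>u. g u w)" and linear_right: "linear (g w)"
  using bil by (auto simp: bilinear_def)

lemma eqI: "(\<And>v. g u v = g w v) \<Longrightarrow> u = w"
  using nondeg[of "u - w"] by (simp add: g_diff)

text \<open>
  Vectors represent all linear functionals: the linear map that sends \<open>w\<close> to the coefficients of
  \<open>g w\<close> is injective by nondegeneracy, hence surjective. So the definite description in \<open>ricop_of\<close> is
  meaningful.
\<close>

lemma represent:
  assumes a: "linear a" shows "\<exists>!w. \<forall>v. g w v = a v"
proof -
  define G where "G w = (\<Sum>b\<in>Basis. g w b *\<^sub>R b)" for w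
  have Gb: "G w \<bullet> b = g w b" if "b \<in> Basis" for w b
    using that by (simp add: G_def inner_sum_left inner_Basis if_distrib cong: if_cong)
  have basis_ext: "h v = (\<Sum>b\<in>Basis. (v \<bullet> b) * h b)" if h: "linear h" for h :: "'a \<Rightarrow> real" and v
    using lin_trace_rank_one[OF h, of v] by (simp add: lin_trace_def mult.commute)
  have ext: "\<forall>v. g w v = a v" if "\<And>b. b \<in> Basis \<Longrightarrow> g w b = a b" for w
  proof
    fix v
    have "(\<Sum>b\<in>Basis. (v \<bullet> b) * g w b) = (\<Sum>b\<in>Basis. (v \<bullet> b) * a b)" using that by simp
    then show "g w v = a v" by (simp only: basis_ext[OF linear_right[of w], of v] basis_ext[OF a, of v])
  qed
  have "linear G"
    by (rule linearI) (simp_all add: G_def g_add g_scale scaleR_add_left sum.distrib scaleR_sum_right)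
  moreover have "inj G"
  proof (rule injI)
    fix u w assume "G u = G w"
    then have "g u b = g w b" if "b \<in> Basis" for b using Gb[OF that] by metis
    then have "(\<Sum>b\<in>Basis. (v \<bullet> b) * g u b) = (\<Sum>b\<in>Basis. (v \<bullet> b) * g w b)" for v by simp
    then have "g u v = g w v" for v
      by (simp only: basis_ext[OF linear_right[of u], of v] basis_ext[OF linear_right[of w], of v])
    then show "u = w" by (rule eqI)
  qed
  ultimately have "surj G" using linear_injective_imp_surjective[of G] by blast
  then obtain w where w: "G w = (\<Sum>b\<in>Basis. a b *\<^sub>R b)" by (metis surjD)
  have "g w b = a b" if "b \<in> Basis" for b
    using Gb[OF that, of w] that by (simp add: w inner_sum_left inner_Basis if_distrib cong: if_cong)
  then have w: "\<forall>v. g w v = a v" by (rule ext)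
  show ?thesis
  proof (rule ex1I[of _ w])
    fix w' assume "\<forall>v. g w' v = a v"
    with w show "w' = w" by (intro eqI) simp
  qed (rule w)
qed

lemma linear_ric_of:
  assumes "trilinear F"
  shows "linear (ric_of F u)" "linear (\<lambda>v. ric_of F v w)"
  unfolding ric_of_def[abs_def] using assms
  by (intro linear_lin_trace; simp add: trilinear_def)+

lemma g_ricop_of: "trilinear F \<Longrightarrow> g (ricop_of g F u) v = ric_of F u v"
  using theI'[OF represent[OF linear_ric_of(1)]] unfolding ricop_of_def by blast

lemma trilinear_const_curv: "trilinear (const_curv g)"
  unfolding trilinear_def const_curv_def
  by (intro conjI allI linearI) (simp_all add: g_simps algebra_simps)

text \<open>
  The conformal tensor is linear in the curvature tensor and vanishes on \<open>const_curv g\<close>, whose Ricci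
  form is \<open>2n g\<close> and whose scalar curvature is \<open>2n (2n + 1)\<close>.
\<close>

lemma weyl_of_shift:
  assumes F: "trilinear F" and n: "DIM('a) = 2 * n + 1" "n \<ge> 1"
    and H: "\<And>u v w. H u v w = F u v w + k *\<^sub>R const_curv g u v w"
  shows "weyl_of n g H u v w = weyl_of n g F u v w"
proof -
  have "trilinear H"
    using F trilinear_const_curv unfolding trilinear_def H
    by (auto intro!: linear_compose_add linear_compose_scale_right)
  have ric: "ric_of H v w = ric_of F v w + k * (2 * real n) * g v w" for v w
  proof -
    have "ric_of H v w = ric_of F v w + k * (g v w * real DIM('a) - g v w)"
      unfolding ric_of_def H const_curv_def lin_trace_add lin_trace_diff lin_trace_scaleR
        lin_trace_id lin_trace_rank_one[OF linear_left] ..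
    then show ?thesis by (simp add: n algebra_simps)
  qed
  have op: "ricop_of g H u = ricop_of g F u + (k * (2 * real n)) *\<^sub>R u" for u
    by (rule eqI) (simp add: g_ricop_of F \<open>trilinear H\<close> ric g_simps)
  have tr: "lin_trace (ricop_of g H) = lin_trace (ricop_of g F) + k * (2 * real n) * (2 * real n + 1)"
    unfolding op[abs_def] lin_trace_add lin_trace_scaleR lin_trace_id by (simp add: n)
  define N where "N = 2 * real n"
  have N: "N > 1" using n by (simp add: N_def)
  define C where "C = const_curv g u v w"
  have "weyl_of n g H u v w = weyl_of n g F u v w
     + (k *\<^sub>R C - (1 / (N - 1)) *\<^sub>R ((k * N) *\<^sub>R C + (k * N) *\<^sub>R C) + (k * N * (N + 1) / (N * (N - 1))) *\<^sub>R C)"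
    unfolding weyl_of_def ric op tr H N_def[symmetric] C_def
    by (simp add: const_curv_def algebra_simps add_divide_distrib)
  also have "k *\<^sub>R C - (1 / (N - 1)) *\<^sub>R ((k * N) *\<^sub>R C + (k * N) *\<^sub>R C) + (k * N * (N + 1) / (N * (N - 1))) *\<^sub>R C
     = (k - (1 / (N - 1)) * (k * N + k * N) + k * N * (N + 1) / (N * (N - 1))) *\<^sub>R C"
    by (simp only: scaleR_left_distrib scaleR_left_diff_distrib scaleR_right_distrib distrib_left scaleR_scaleR)
  also have "k - (1 / (N - 1)) * (k * N + k * N) + k * N * (N + 1) / (N * (N - 1)) = 0"
    using N by (simp add: divide_simps) (simp add: algebra_simps)
  finally show ?thesis by simp
qed

end

section \<open>Curvature tensors compatible with an almost contact structure\<close>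

text \<open>
  The assumptions on \<open>T\<close> are those satisfied at each point by \<open>R + \<epsilon> B\<close> on a Kenmotsu manifold, with
  \<open>B\<close> the tensor \<open>const_curv g\<close>.
\<close>

locale contact_curvature = nondegenerate_form g for g :: "'a::euclidean_space \<Rightarrow> 'a \<Rightarrow> real" +
  fixes n :: nat and \<phi> :: "'a \<Rightarrow> 'a" and \<xi> :: 'a and \<eta> :: "'a \<Rightarrow> real" and \<epsilon> :: real
    and T :: "'a \<Rightarrow> 'a \<Rightarrow> 'a \<Rightarrow> 'a"
  assumes dim: "DIM('a) = 2 * n + 1" and n: "n \<ge> 2"
    and \<phi>_linear: "linear \<phi>" and \<eta>_linear: "linear \<eta>" and eps: "\<epsilon> * \<epsilon> = 1"
    and \<phi>_\<phi>: "\<phi> (\<phi> v) = - v + \<eta> v *\<^sub>R \<xi>" and \<eta>_\<xi>: "\<eta> \<xi> = 1" and \<phi>_\<xi>: "\<phi> \<xi> = 0"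
    and \<eta>_\<phi>: "\<eta> (\<phi> v) = 0"
    and g_\<phi>: "g (\<phi> u) (\<phi> v) = g u v - \<epsilon> * \<eta> u * \<eta> v"
    and T_trilinear: "trilinear T"
    and T_skew: "T u v w = - T v u w"
    and T_g_skew: "g (T u v w) z = - g w (T u v z)"
    and T_bianchi: "T u v w + T v w u + T w u v = 0"
    and T_xi: "T u v \<xi> = 0"
    and T_\<phi>: "T u v (\<phi> w) = \<phi> (T u v w)"
begin

lemma eta_eq: "\<eta> u = \<epsilon> * g u \<xi>"
proof -
  have "g u \<xi> = \<epsilon> * \<eta> u" using g_\<phi>[of u \<xi>] by (simp add: \<phi>_\<xi> \<eta>_\<xi> g_zero)
  then show ?thesis using eps by (simp add: mult.assoc[symmetric])
qed

lemma g_xi: "g u \<xi> = \<epsilon> * \<eta> u"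
  using eps by (simp add: eta_eq mult.assoc[symmetric])

lemma g_\<phi>_skew: "g (\<phi> u) v = - g u (\<phi> v)"
proof -
  have "g (\<phi> (\<phi> u)) (\<phi> v) = g (\<phi> u) v" by (simp add: g_\<phi> \<eta>_\<phi>)
  moreover have "g \<xi> (\<phi> v) = 0" by (simp add: sym[of \<xi>] g_xi \<eta>_\<phi>)
  ultimately show ?thesis by (simp add: \<phi>_\<phi> g_simps)
qed

text \<open>
  By the Bianchi identity and \<open>T u v \<xi> = 0\<close>, the trilinear form \<open>g (T \<xi> u v) w\<close> is symmetric in \<open>u\<close>
  and \<open>v\<close>; it is skew in \<open>v\<close> and \<open>w\<close>. Such a form is zero.
\<close>

lemma T_xi_left: "T \<xi> u v = 0"
proof (rule nondeg)
  fix w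
  define b where "b u v w = g (T \<xi> u v) w" for u v w
  have 1: "b u v w = - b u w v" for u v w
    unfolding b_def using T_g_skew[of \<xi> u v w] sym[of v] by simp
  have 2: "b u v w = b v u w" for u v w
    unfolding b_def using T_bianchi[of \<xi> u v] T_skew[of v \<xi> u] by (simp add: T_xi)
  have "b u v w = - b u v w"
    using 1[of v u w] 2[of v w u] 1[of w v u] 2[of u w v] 1[of u w v] 2[of u v w] by simp
  then have "b u v w = 0" by linarith
  then show "g (T \<xi> u v) w = 0" by (simp add: b_def)
qed

lemma T_xi_mid: "T u \<xi> v = 0"
  using T_skew[of u \<xi> v] by (simp add: T_xi_left)

text \<open>
  The projection to \<open>ker \<eta>\<close> along \<open>\<xi>\<close>. Composing with it turns a trace over the whole space into a
  trace over the horizontal space.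
\<close>

definition hproj :: "'a \<Rightarrow> 'a" where "hproj u = u - \<eta> u *\<^sub>R \<xi>"

lemma \<eta>_hproj: "\<eta> (hproj u) = 0"
  by (simp add: hproj_def linear_diff[OF \<eta>_linear] linear_cmul[OF \<eta>_linear] \<eta>_\<xi>)

lemma hproj_trace: "lin_trace hproj = 2 * real n"
  unfolding hproj_def[abs_def] lin_trace_diff lin_trace_rank_one[OF \<eta>_linear] lin_trace_id
  by (simp add: \<eta>_\<xi> dim)

lemma eq_hproj_of_xi:
  assumes "linear f" "f \<xi> = 0" shows "f (hproj u) = f u"
  by (simp add: hproj_def linear_diff[OF assms(1)] linear_cmul[OF assms(1)] assms(2))

lemma T_hproj: "T (hproj u) v w = T u v w" "T u (hproj v) w = T u v w" "T u v (hproj w) = T u v w"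
  using T_trilinear
  by (auto simp: trilinear_def T_xi T_xi_left T_xi_mid intro!: eq_hproj_of_xi[of "\<lambda>u. T u v w"] eq_hproj_of_xi[of "\<lambda>v. T u v w"] eq_hproj_of_xi[of "T u v"])

lemma ric_xi: "ric_of T u \<xi> = 0" "ric_of T \<xi> u = 0"
  by (simp_all add: ric_of_def T_xi T_xi_mid lin_trace_zero)

lemma ric_hproj: "ric_of T (hproj u) w = ric_of T u w"
  by (rule eq_hproj_of_xi[OF linear_ric_of(2)[OF T_trilinear] ric_xi(2)])

lemma g_hproj: "\<eta> w = 0 \<Longrightarrow> g (hproj u) w = g u w"
  by (rule eq_hproj_of_xi[OF linear_left]) (simp add: sym[of \<xi>] g_xi)

abbreviation "S \<equiv> ricop_of g T"
abbreviation "\<sigma> \<equiv> lin_trace S"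

lemma g_S: "g (S u) v = ric_of T u v"
  by (rule g_ricop_of[OF T_trilinear])

lemma S_hproj: "S (hproj u) = S u"
  by (rule eqI) (simp add: g_S ric_hproj)

lemma \<eta>_S: "\<eta> (S u) = 0"
  by (simp add: eta_eq g_S ric_xi)

lemma \<eta>_T: "\<eta> (T u v w) = 0"
  by (simp add: eta_eq T_g_skew T_xi g_zero)

text \<open>
  If all horizontal vectors were null, then \<open>g\<close> would vanish on \<open>ker \<eta>\<close> by polarisation. As \<open>\<xi>\<close> is
  orthogonal to \<open>ker \<eta>\<close>, nondegeneracy would make \<open>ker \<eta>\<close> trivial, but its dimension is \<open>2n\<close>.
\<close>

lemma nonnull_horizontal: "\<exists>v. \<eta> v = 0 \<and> g v v \<noteq> 0"
proof (rule ccontr)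
  assume "\<not> ?thesis"
  then have null: "g v v = 0" if "\<eta> v = 0" for v using that by blast
  have pol: "g u v = 0" if "\<eta> u = 0" "\<eta> v = 0" for u v
    using null[OF that(1)] null[OF that(2)] null[of "u + v"] that sym[of u v]
    by (simp add: linear_add[OF \<eta>_linear] g_add)
  have "hproj u = 0" for u
  proof (rule nondeg)
    fix w
    have "g (hproj u) w = g (hproj u) (hproj w) + \<eta> w * g (hproj u) \<xi>"
      by (simp add: hproj_def g_simps algebra_simps)
    then show "g (hproj u) w = 0" by (simp add: pol \<eta>_hproj g_xi)
  qed
  then have "lin_trace hproj = 0" by (simp add: lin_trace_def)
  then show False using hproj_trace n by simp
qed

text \<open>
  The horizontal space has one dimension less than the coefficients of \<open>weyl_of\<close> are made for.
  Therefore the contraction over it does not vanish identically, but is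
  \<open>(ric_of T - \<sigma>/(2n) g) / (2n - 1)\<close>. Once the Ricci form is known, \<open>T\<close> is \<open>k\<close> times \<open>const_curv g\<close> on
  horizontal vectors, and the commutation of \<open>T\<close> with \<open>\<phi>\<close> excludes \<open>k \<noteq> 0\<close>.
\<close>

theorem flat_imp_zero:
  assumes flat: "\<And>u v w. \<phi> (\<phi> (weyl_of n g T (\<phi> u) (\<phi> v) (\<phi> w))) = 0"
  shows "T u v w = 0"
proof -
  define N where "N = 2 * real n"
  have N: "N \<ge> 4" using n by (simp add: N_def)
  have weyl: "weyl_of n g T u v w = 0" if h: "\<eta> u = 0" "\<eta> v = 0" "\<eta> w = 0" for u v w
  proof -
    \<comment> \<open>A horizontal vector is in the image of \<open>\<phi>\<close>, and \<open>\<phi>\<^sup>2\<close> is minus the identity on horizontal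
      vectors.\<close>
    have "u = \<phi> (\<phi> (- u))" if "\<eta> u = 0" for u
      using that by (simp add: \<phi>_\<phi> linear_neg[OF \<eta>_linear])
    then have "\<phi> (\<phi> (weyl_of n g T u v w)) = 0"
      using flat[of "\<phi> (- u)" "\<phi> (- v)" "\<phi> (- w)"] h by simp
    moreover have "\<eta> (weyl_of n g T u v w) = 0"
      by (simp add: weyl_of_def const_curv_def linear_add[OF \<eta>_linear] linear_diff[OF \<eta>_linear]
          linear_cmul[OF \<eta>_linear] \<eta>_T \<eta>_S h)
    ultimately show ?thesis by (simp add: \<phi>_\<phi>)
  qed
  have ric: "ric_of T v w = \<sigma> / N * g v w" if h: "\<eta> v = 0" "\<eta> w = 0" for v w
  proof -
    have "weyl_of n g T (hproj u) v w = 0" for u by (rule weyl[OF \<eta>_hproj h])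
    then have "lin_trace (\<lambda>u. weyl_of n g T (hproj u) v w) = 0" by (simp add: lin_trace_def)
    moreover have "lin_trace (\<lambda>u. weyl_of n g T (hproj u) v w) = ric_of T v w
      - 1 / (N - 1) * (ric_of T v w * N + g v w * \<sigma> - ric_of T v w - g (S v) w)
      + \<sigma> / (N * (N - 1)) * (g v w * N - g v w)"
      unfolding weyl_of_def const_curv_def T_hproj ric_hproj S_hproj g_hproj[OF h(2)]
        lin_trace_add lin_trace_diff lin_trace_scaleR lin_trace_rank_one[OF linear_left]
        lin_trace_rank_one[OF linear_ric_of(2)[OF T_trilinear]] hproj_trace
        ric_of_def[of T v w, symmetric] N_def by simp
    ultimately show ?thesis using N unfolding g_S by (simp add: divide_simps) (simp add: algebra_simps)
  qed
  have S: "S v = (\<sigma> / N) *\<^sub>R v" if h: "\<eta> v = 0" for v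
  proof (rule eqI)
    fix w
    have w: "w = hproj w + \<eta> w *\<^sub>R \<xi>" by (simp add: hproj_def)
    have "g (S v) (hproj w) = \<sigma> / N * g v (hproj w)" by (simp add: g_S ric h \<eta>_hproj)
    moreover have "g (S v) \<xi> = 0" "g v \<xi> = 0" by (simp_all add: \<eta>_S g_xi h)
    ultimately show "g (S v) w = g ((\<sigma> / N) *\<^sub>R v) w"
      by (subst (1 2) w) (simp add: g_simps del: times_divide_eq_left)
  qed
  define k where "k = \<sigma> / (N * (N - 1))"
  have T: "T u v w = k *\<^sub>R const_curv g u v w" if h: "\<eta> u = 0" "\<eta> v = 0" "\<eta> w = 0" for u v w
  proof -
    define a m C where "a = 1 / (N - 1)" and "m = \<sigma> / N" and "C = const_curv g u v w"
    have "weyl_of n g T u v w = T u v w - a *\<^sub>R (m *\<^sub>R C + m *\<^sub>R C) + k *\<^sub>R C"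
      unfolding weyl_of_def ric[OF h(1,3)] ric[OF h(2,3)] S[OF h(1)] S[OF h(2)]
        N_def[symmetric] k_def[symmetric] a_def[symmetric] m_def[symmetric] C_def
      by (simp add: const_curv_def algebra_simps)
    then have "T u v w = a *\<^sub>R (m *\<^sub>R C + m *\<^sub>R C) - k *\<^sub>R C"
      using weyl[OF h] by (simp add: algebra_simps eq_diff_eq)
    also have "\<dots> = (a * (m + m) - k) *\<^sub>R C"
      by (simp only: scaleR_left_distrib scaleR_left_diff_distrib scaleR_right_distrib distrib_left scaleR_scaleR)
    also have "a * (m + m) - k = k"
      using N by (simp add: k_def a_def m_def divide_simps)
    also have "C = const_curv g u v w" by (simp add: C_def)
    finally show ?thesis .
  qed
  have "k = 0"
  proof -
    obtain v where v: "\<eta> v = 0" "g v v \<noteq> 0" using nonnull_horizontal by blast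
    have vv: "g v (\<phi> v) = 0" using g_\<phi>_skew[of v v] sym[of "\<phi> v" v] by simp
    have "k *\<^sub>R (g v v *\<^sub>R u - g u v *\<^sub>R v - g u (\<phi> v) *\<^sub>R \<phi> v) = 0" if u: "\<eta> u = 0" for u
    proof -
      \<comment> \<open>With \<open>\<phi> v\<close> as third argument the term along \<open>\<phi> u\<close> drops out, as \<open>g v (\<phi> v) = 0\<close>.\<close>
      have "T u v (\<phi> (\<phi> v)) = \<phi> (T u v (\<phi> v))" by (rule T_\<phi>)
      then show ?thesis
        by (simp add: T u v \<eta>_\<phi> \<phi>_\<phi> linear_neg[OF \<eta>_linear] const_curv_def g_simps vv
            linear_cmul[OF \<phi>_linear] linear_neg[OF \<phi>_linear] algebra_simps)
    qed
    \<comment> \<open>Now take the trace over the horizontal vectors \<open>u\<close>.\<close>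
    from this[OF \<eta>_hproj]
    have z: "k *\<^sub>R (g v v *\<^sub>R hproj u - g u v *\<^sub>R v - g u (\<phi> v) *\<^sub>R \<phi> v) = 0" for u
      by (simp only: g_hproj v(1) \<eta>_\<phi>)
    have "lin_trace (\<lambda>u. k *\<^sub>R (g v v *\<^sub>R hproj u - g u v *\<^sub>R v - g u (\<phi> v) *\<^sub>R \<phi> v)) = 0"
      unfolding z by (rule lin_trace_zero)
    moreover have "lin_trace (\<lambda>u. k *\<^sub>R (g v v *\<^sub>R hproj u - g u v *\<^sub>R v - g u (\<phi> v) *\<^sub>R \<phi> v)) =
       k * (g v v * N - g v v - g (\<phi> v) (\<phi> v))"
      unfolding lin_trace_diff lin_trace_scaleR lin_trace_rank_one[OF linear_left] hproj_trace N_def ..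
    ultimately have "k * ((N - 2) * g v v) = 0" by (simp add: g_\<phi> v algebra_simps)
    then show ?thesis using v N by simp
  qed
  then have "T (hproj u) (hproj v) (hproj w) = 0" by (simp add: T \<eta>_hproj)
  then show ?thesis by (simp add: T_hproj)
qed

end

section \<open>The curvature tensor of the Levi-Civita connection\<close>

context atlas
begin

lemma vf_deriv_add_vf:
  assumes "smooth_fun A f"
  shows "vf_deriv A (\<lambda>p. X p + Y p) f p = vf_deriv A X f p + vf_deriv A Y f p"
  using linear_add[OF vf_deriv_linear[OF assms]] by (simp add: vf_deriv_def)

lemma vf_deriv_0_vf:
  assumes "smooth_fun A f" shows "vf_deriv A (\<lambda>p. 0) f p = 0"
  using linear_0[OF vf_deriv_linear[OF assms]] by (simp add: vf_deriv_def)

text \<open>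
  A tangent vector is determined by its action on smooth functions, and there the identity is the
  one for commutators of operators.
\<close>

lemma jacobi_identity:
  assumes X: "smooth_vf A X" and Y: "smooth_vf A Y" and Z: "smooth_vf A Z"
  shows "lie_bracket A X (lie_bracket A Y Z) p + lie_bracket A Y (lie_bracket A Z X) p
    + lie_bracket A Z (lie_bracket A X Y) p = 0"
proof -
  have br: "vf_deriv A (lie_bracket A U (lie_bracket A V W)) f p =
     vf_deriv A U (vf_deriv A V (vf_deriv A W f)) p - vf_deriv A U (vf_deriv A W (vf_deriv A V f)) p
     - (vf_deriv A V (vf_deriv A W (vf_deriv A U f)) p - vf_deriv A W (vf_deriv A V (vf_deriv A U f)) p)"
    if s: "smooth_vf A U" "smooth_vf A V" "smooth_vf A W" and f: "smooth_fun A f" for U V W f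
  proof -
    have e: "vf_deriv A (lie_bracket A V W) f =
        (\<lambda>q. vf_deriv A V (vf_deriv A W f) q - vf_deriv A W (vf_deriv A V f) q)"
      by (rule ext) (rule vf_deriv_lie_bracket[OF s(2,3) f])
    show ?thesis
      unfolding vf_deriv_lie_bracket[OF s(1) smooth_vf_lie_bracket[OF s(2,3)] f] e
        vf_deriv_lie_bracket[OF s(2,3) smooth_fun_vf_deriv[OF s(1) f]]
      by (simp add: vf_deriv_diff_fun smooth_fun_vf_deriv s f)
  qed
  have "(\<lambda>p. lie_bracket A X (lie_bracket A Y Z) p + lie_bracket A Y (lie_bracket A Z X) p
    + lie_bracket A Z (lie_bracket A X Y) p) p = (\<lambda>p. 0) p"
    by (rule tangent_vector_eqI) (simp add: vf_deriv_add_vf vf_deriv_0_vf br X Y Z)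
  then show ?thesis by simp
qed

text \<open>
  The choice is the one made in \<open>endo_at\<close>, so that traces of operators on vector fields become
  traces of linear maps.
\<close>

definition ext_vf :: "'m \<Rightarrow> 'e \<Rightarrow> 'm \<Rightarrow> 'e" where
  "ext_vf p v = (SOME X. smooth_vf A X \<and> X p = v)"

lemma smooth_ext_vf: "smooth_vf A (ext_vf p v)" and ext_vf_at: "ext_vf p v p = v"
  using someI_ex[OF smooth_vf_extension[of p v]] by (auto simp: ext_vf_def)

lemma trace_at_ext: "trace_at A T p = lin_trace (\<lambda>v. T (ext_vf p v) p)"
  by (simp add: trace_at_def endo_at_def lin_trace_def ext_vf_def)

end

locale levi_civita_manifold = atlas A
  for A :: "('m::{t2_space, second_countable_topology}, 'e::euclidean_space) chart set" +
  fixes g :: "'m \<Rightarrow> 'e \<Rightarrow> 'e \<Rightarrow> real" and nabla :: "('m \<Rightarrow> 'e) \<Rightarrow> ('m \<Rightarrow> 'e) \<Rightarrow> 'm \<Rightarrow> 'e"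
  assumes metric: "pseudo_riemannian_metric A g" and lc: "levi_civita A g nabla"
begin

abbreviation "vf \<equiv> smooth_vf A"
abbreviation "sf \<equiv> smooth_fun A"
abbreviation "R \<equiv> curvature A nabla"

lemma form_at: "nondegenerate_form (g p)"
  using metric unfolding pseudo_riemannian_metric_def by unfold_locales blast+

lemmas g_simps = nondegenerate_form.g_simps[OF form_at]

lemma g_sym: "g p u v = g p v u"
  by (rule nondegenerate_form.sym[OF form_at])

lemma smooth_g: "vf X \<Longrightarrow> vf Y \<Longrightarrow> sf (\<lambda>p. g p (X p) (Y p))"
  using metric by (simp add: pseudo_riemannian_metric_def)

lemma conn: "affine_connection A nabla"
  using lc by (simp add: levi_civita_def)

lemma smooth_nabla: "vf X \<Longrightarrow> vf Y \<Longrightarrow> vf (nabla X Y)"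
  using conn by (simp add: affine_connection_def)

lemma nabla_add_left: "vf X \<Longrightarrow> vf X' \<Longrightarrow> vf Y \<Longrightarrow> nabla (\<lambda>p. X p + X' p) Y = (\<lambda>p. nabla X Y p + nabla X' Y p)"
  and nabla_scale_left: "sf f \<Longrightarrow> vf X \<Longrightarrow> vf Y \<Longrightarrow> nabla (\<lambda>p. f p *\<^sub>R X p) Y = (\<lambda>p. f p *\<^sub>R nabla X Y p)"
  and nabla_add: "vf X \<Longrightarrow> vf Y \<Longrightarrow> vf Y' \<Longrightarrow> nabla X (\<lambda>p. Y p + Y' p) = (\<lambda>p. nabla X Y p + nabla X Y' p)"
  and nabla_scale: "sf f \<Longrightarrow> vf X \<Longrightarrow> vf Y \<Longrightarrow> nabla X (\<lambda>p. f p *\<^sub>R Y p) = (\<lambda>p. f p *\<^sub>R nabla X Y p + vf_deriv A X f p *\<^sub>R Y p)"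
  using conn by (simp_all add: affine_connection_def)

lemma nabla_diff_left:
  assumes "vf X" "vf X'" "vf Y"
  shows "nabla (\<lambda>p. X p - X' p) Y = (\<lambda>p. nabla X Y p - nabla X' Y p)"
  using nabla_add_left[OF assms(1) smooth_vf_scaleR[OF smooth_fun_const assms(2)] assms(3), of "-1"]
    nabla_scale_left[OF smooth_fun_const assms(2,3), of "-1"]
  by simp

lemma nabla_diff:
  assumes "vf X" "vf Y" "vf Y'"
  shows "nabla X (\<lambda>p. Y p - Y' p) = (\<lambda>p. nabla X Y p - nabla X Y' p)"
  using nabla_add[OF assms(1,2) smooth_vf_scaleR[OF smooth_fun_const assms(3)], of "-1"]
    nabla_scale[OF smooth_fun_const assms(1,3), of "-1"]
  by (simp add: vf_deriv_const)

lemma nabla_0: "vf X \<Longrightarrow> nabla X (\<lambda>p. 0) = (\<lambda>p. 0)"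
  using nabla_scale[OF smooth_fun_const _ smooth_vf_0, of X 0] by (simp add: vf_deriv_const)

lemma lie_bracket_eq: "vf X \<Longrightarrow> vf Y \<Longrightarrow> lie_bracket A X Y = (\<lambda>p. nabla X Y p - nabla Y X p)"
  using lc by (simp add: levi_civita_def)

lemma vf_deriv_g:
  "vf X \<Longrightarrow> vf Y \<Longrightarrow> vf Z \<Longrightarrow>
    vf_deriv A X (\<lambda>q. g q (Y q) (Z q)) p = g p (nabla X Y p) (Z p) + g p (Y p) (nabla X Z p)"
  using lc by (simp add: levi_civita_def)

lemma nabla_bracket:
  "vf X \<Longrightarrow> vf Y \<Longrightarrow> vf Z \<Longrightarrow> nabla (lie_bracket A X Y) Z p = nabla (nabla X Y) Z p - nabla (nabla Y X) Z p"
  by (simp add: lie_bracket_eq nabla_diff_left smooth_nabla)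

lemma R_skew: "vf X \<Longrightarrow> vf Y \<Longrightarrow> vf Z \<Longrightarrow> R X Y Z p = - R Y X Z p"
  by (simp add: curvature_def nabla_bracket)

lemma R_add_left:
  assumes "vf X" "vf X'" "vf Y" "vf Z"
  shows "R (\<lambda>q. X q + X' q) Y Z p = R X Y Z p + R X' Y Z p"
  using assms by (simp add: curvature_def nabla_bracket nabla_add_left nabla_add smooth_nabla smooth_vf_add)

lemma R_scale_left:
  assumes "sf f" "vf X" "vf Y" "vf Z"
  shows "R (\<lambda>q. f q *\<^sub>R X q) Y Z p = f p *\<^sub>R R X Y Z p"
  using assms by (simp add: curvature_def nabla_bracket nabla_scale_left nabla_scale nabla_add_left
      smooth_nabla smooth_vf_scaleR smooth_fun_vf_deriv algebra_simps)

lemma R_add_right: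
  assumes "vf X" "vf Y" "vf Z" "vf Z'"
  shows "R X Y (\<lambda>q. Z q + Z' q) p = R X Y Z p + R X Y Z' p"
  using assms by (simp add: curvature_def nabla_bracket nabla_add smooth_nabla smooth_vf_add)

text \<open>
  The second derivatives of \<open>f\<close> cancel because the Lie bracket acts on functions as a commutator.
\<close>

lemma R_scale_right:
  assumes "sf f" "vf X" "vf Y" "vf Z"
  shows "R X Y (\<lambda>q. f q *\<^sub>R Z q) p = f p *\<^sub>R R X Y Z p"
  using assms
  by (simp add: curvature_def nabla_scale nabla_add smooth_nabla smooth_vf_scaleR smooth_fun_vf_deriv
      smooth_vf_lie_bracket vf_deriv_lie_bracket algebra_simps)

lemma R_tensor:
  assumes s: "vf X" "vf X'" "vf Y" "vf Y'" "vf Z" "vf Z'"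
    and e: "X p = X' p" "Y p = Y' p" "Z p = Z' p"
  shows "R X Y Z p = R X' Y' Z' p"
proof -
  have left: "R U V W p = R U' V W p" if "vf U" "vf U'" "vf V" "vf W" "U p = U' p" for U U' V W
    by (rule tensorial[where T="\<lambda>U. R U V W p" and p=p]) (simp_all add: that R_add_left R_scale_left)
  have "R X Y Z p = R X' Y Z p" by (rule left) (simp_all add: s e)
  also have "\<dots> = - R Y X' Z p" by (rule R_skew) (simp_all add: s)
  also have "R Y X' Z p = R Y' X' Z p" by (rule left) (simp_all add: s e)
  also have "\<dots> = - R X' Y' Z p" by (rule R_skew) (simp_all add: s)
  also have "R X' Y' Z p = R X' Y' Z' p"
    by (rule tensorial[where T="\<lambda>U. R X' Y' U p" and p=p]) (simp_all add: s e R_add_right R_scale_right)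
  finally show ?thesis by simp
qed

text \<open>
  The commutator of \<open>X\<close> and \<open>Y\<close> minus the Lie bracket annihilates the function \<open>g(Z,W)\<close>; metric
  compatibility expands this into the two terms with the curvature.
\<close>

lemma R_g_skew:
  assumes X: "vf X" and Y: "vf Y" and Z: "vf Z" and W: "vf W"
  shows "g p (R X Y Z p) (W p) = - g p (Z p) (R X Y W p)"
proof -
  have d2: "vf_deriv A U (vf_deriv A V (\<lambda>q. g q (Z q) (W q))) p =
     g p (nabla U (nabla V Z) p) (W p) + g p (nabla V Z p) (nabla U W p)
     + (g p (nabla U Z p) (nabla V W p) + g p (Z p) (nabla U (nabla V W) p))"
    if s: "vf U" "vf V" for U V
  proof -
    have "vf_deriv A V (\<lambda>q. g q (Z q) (W q)) = (\<lambda>q. g q (nabla V Z q) (W q) + g q (Z q) (nabla V W q))"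
      by (rule ext) (rule vf_deriv_g[OF s(2) Z W])
    then show ?thesis
      by (simp add: vf_deriv_add_fun vf_deriv_g smooth_g smooth_nabla s Z W)
  qed
  have "vf_deriv A (lie_bracket A X Y) (\<lambda>q. g q (Z q) (W q)) p =
    g p (nabla (lie_bracket A X Y) Z p) (W p) + g p (Z p) (nabla (lie_bracket A X Y) W p)"
    by (rule vf_deriv_g[OF smooth_vf_lie_bracket[OF X Y] Z W])
  moreover have "vf_deriv A (lie_bracket A X Y) (\<lambda>q. g q (Z q) (W q)) p =
    vf_deriv A X (vf_deriv A Y (\<lambda>q. g q (Z q) (W q))) p - vf_deriv A Y (vf_deriv A X (\<lambda>q. g q (Z q) (W q))) p"
    by (rule vf_deriv_lie_bracket[OF X Y smooth_g[OF Z W]])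
  ultimately show ?thesis
    by (simp add: d2 X Y curvature_def g_simps)
qed

text \<open>
  As the torsion vanishes, the cyclic sum of the curvature is the cyclic sum of the double brackets.
\<close>

lemma R_bianchi:
  assumes X: "vf X" and Y: "vf Y" and Z: "vf Z"
  shows "R X Y Z p + R Y Z X p + R Z X Y p = 0"
proof -
  have br: "lie_bracket A U (lie_bracket A V W) p =
      nabla U (nabla V W) p - nabla U (nabla W V) p - nabla (lie_bracket A V W) U p"
    if "vf U" "vf V" "vf W" for U V W
  proof -
    have "lie_bracket A U (lie_bracket A V W) p =
      nabla U (lie_bracket A V W) p - nabla (lie_bracket A V W) U p"
      by (simp add: lie_bracket_eq[OF that(1) smooth_vf_lie_bracket[OF that(2,3)]])
    also have "nabla U (lie_bracket A V W) p = nabla U (nabla V W) p - nabla U (nabla W V) p"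
      by (simp add: lie_bracket_eq that nabla_diff smooth_nabla)
    finally show ?thesis .
  qed
  show ?thesis
    using jacobi_identity[OF X Y Z, of p] unfolding br[OF X Y Z] br[OF Y Z X] br[OF Z X Y]
    by (simp add: curvature_def algebra_simps)
qed

definition curv_at :: "'m \<Rightarrow> 'e \<Rightarrow> 'e \<Rightarrow> 'e \<Rightarrow> 'e" where
  "curv_at p u v w = R (ext_vf p u) (ext_vf p v) (ext_vf p w) p"

lemma R_eq_curv_at: "vf X \<Longrightarrow> vf Y \<Longrightarrow> vf Z \<Longrightarrow> R X Y Z p = curv_at p (X p) (Y p) (Z p)"
  unfolding curv_at_def by (rule R_tensor) (simp_all add: smooth_ext_vf ext_vf_at)

lemma curv_at_skew: "curv_at p u v w = - curv_at p v u w"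
  unfolding curv_at_def by (rule R_skew) (rule smooth_ext_vf)+

lemma trilinear_curv_at: "trilinear (curv_at p)"
proof -
  have left: "linear (\<lambda>u. curv_at p u v w)" for v w
  proof (rule linearI)
    fix u u' and a :: real
    show "curv_at p (u + u') v w = curv_at p u v w + curv_at p u' v w"
      using R_add_left[of "ext_vf p u" "ext_vf p u'" "ext_vf p v" "ext_vf p w" p]
      by (simp add: R_eq_curv_at smooth_ext_vf smooth_vf_add ext_vf_at)
    show "curv_at p (a *\<^sub>R u) v w = a *\<^sub>R curv_at p u v w"
      using R_scale_left[OF smooth_fun_const[of a], of "ext_vf p u" "ext_vf p v" "ext_vf p w" p]
      by (simp add: R_eq_curv_at smooth_ext_vf smooth_vf_scaleR smooth_fun_const ext_vf_at)
  qed
  have right: "linear (curv_at p u v)" for u v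
  proof (rule linearI)
    fix w w' and a :: real
    show "curv_at p u v (w + w') = curv_at p u v w + curv_at p u v w'"
      using R_add_right[of "ext_vf p u" "ext_vf p v" "ext_vf p w" "ext_vf p w'" p]
      by (simp add: R_eq_curv_at smooth_ext_vf smooth_vf_add ext_vf_at)
    show "curv_at p u v (a *\<^sub>R w) = a *\<^sub>R curv_at p u v w"
      using R_scale_right[OF smooth_fun_const[of a], of "ext_vf p u" "ext_vf p v" "ext_vf p w" p]
      by (simp add: R_eq_curv_at smooth_ext_vf smooth_vf_scaleR smooth_fun_const ext_vf_at)
  qed
  have "linear (\<lambda>v. curv_at p u v w)" for u w
    using linear_compose_neg[OF left[of u w]] curv_at_skew[of p u] by simp
  with left right show ?thesis by (simp add: trilinear_def)
qed

lemma curv_at_g_skew: "g p (curv_at p u v w) z = - g p w (curv_at p u v z)"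
  using R_g_skew[of "ext_vf p u" "ext_vf p v" "ext_vf p w" "ext_vf p z" p]
  by (simp add: R_eq_curv_at smooth_ext_vf ext_vf_at)

lemma curv_at_bianchi: "curv_at p u v w + curv_at p v w u + curv_at p w u v = 0"
  using R_bianchi[of "ext_vf p u" "ext_vf p v" "ext_vf p w" p]
  by (simp add: R_eq_curv_at smooth_ext_vf ext_vf_at)

lemma ricci_eq: "vf Y \<Longrightarrow> vf Z \<Longrightarrow> ricci A nabla Y Z p = ric_of (curv_at p) (Y p) (Z p)"
  by (simp add: ricci_def trace_at_ext ric_of_def R_eq_curv_at smooth_ext_vf ext_vf_at)

lemma ricci_op_eq:
  assumes "vf X" shows "ricci_op A g nabla X p = ricop_of (g p) (curv_at p) (X p)"
proof -
  have "(\<forall>Y. vf Y \<longrightarrow> g p w (Y p) = ricci A nabla X Y p) \<longleftrightarrow> (\<forall>v. g p w v = ric_of (curv_at p) (X p) v)" for w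
    using ricci_eq[OF assms] smooth_ext_vf ext_vf_at by metis
  then show ?thesis by (simp add: ricci_op_def ricop_of_def)
qed

lemma scalar_curvature_eq: "scalar_curvature A g nabla p = lin_trace (ricop_of (g p) (curv_at p))"
  by (simp add: scalar_curvature_def trace_at_ext ricci_op_eq smooth_ext_vf ext_vf_at)

lemma conformal_curvature_eq:
  "vf X \<Longrightarrow> vf Y \<Longrightarrow> vf Z \<Longrightarrow>
    conformal_curvature n A g nabla X Y Z p = weyl_of n (g p) (curv_at p) (X p) (Y p) (Z p)"
  by (simp add: conformal_curvature_def weyl_of_def const_curv_def R_eq_curv_at ricci_eq ricci_op_eq
      scalar_curvature_eq)

lemma constant_curvature_iff:
  "constant_curvature A g nabla k \<longleftrightarrow> (\<forall>p u v w. curv_at p u v w = k *\<^sub>R const_curv (g p) u v w)"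
proof
  assume c: "constant_curvature A g nabla k"
  show "\<forall>p u v w. curv_at p u v w = k *\<^sub>R const_curv (g p) u v w"
  proof (intro allI)
    fix p u v w
    have "R (ext_vf p u) (ext_vf p v) (ext_vf p w) p = k *\<^sub>R const_curv (g p) u v w"
      using c by (simp add: constant_curvature_def smooth_ext_vf ext_vf_at const_curv_def)
    then show "curv_at p u v w = k *\<^sub>R const_curv (g p) u v w" by (simp add: curv_at_def)
  qed
qed (simp add: constant_curvature_def R_eq_curv_at const_curv_def)

end

section \<open>Curvature of Kenmotsu pseudo-metric manifolds\<close>

locale kenmotsu_manifold = levi_civita_manifold A g nabla
  for A :: "('m::{t2_space, second_countable_topology}, 'e::euclidean_space) chart set"
    and g nabla +
  fixes \<phi> :: "'m \<Rightarrow> 'e \<Rightarrow> 'e" and \<xi> :: "'m \<Rightarrow> 'e" and \<eta> :: "'m \<Rightarrow> 'e \<Rightarrow> real" and \<epsilon> :: real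
  assumes kenmotsu: "kenmotsu_pseudo_metric A \<phi> \<xi> \<eta> g \<epsilon> nabla"
begin

lemma contact: "almost_contact_pseudo_metric A \<phi> \<xi> \<eta> g \<epsilon>"
  using kenmotsu by (simp add: kenmotsu_pseudo_metric_def)

lemma linear_\<phi>: "linear (\<phi> p)" and linear_\<eta>: "linear (\<eta> p)"
  and smooth_\<phi>: "vf X \<Longrightarrow> vf (\<lambda>p. \<phi> p (X p))"
  and smooth_\<eta>: "vf X \<Longrightarrow> sf (\<lambda>p. \<eta> p (X p))" and smooth_\<xi>: "vf \<xi>"
  using contact by (simp_all add: almost_contact_pseudo_metric_def smooth_endo_def smooth_one_form_def)

lemma \<phi>_\<phi>: "\<phi> p (\<phi> p v) = - v + \<eta> p v *\<^sub>R \<xi> p" and \<eta>_\<xi>: "\<eta> p (\<xi> p) = 1" and \<phi>_\<xi>: "\<phi> p (\<xi> p) = 0"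
  and \<eta>_\<phi>: "\<eta> p (\<phi> p v) = 0"
  using contact by (simp_all add: almost_contact_pseudo_metric_def)

lemma eps: "\<epsilon> * \<epsilon> = 1" "\<epsilon> * (\<epsilon> * x) = x"
  using contact by (auto simp: almost_contact_pseudo_metric_def)

lemma g_\<phi>: "g p (\<phi> p u) (\<phi> p v) = g p u v - \<epsilon> * \<eta> p u * \<eta> p v"
proof -
  have "g p (\<phi> p (ext_vf p u p)) (\<phi> p (ext_vf p v p)) =
      g p (ext_vf p u p) (ext_vf p v p) - \<epsilon> * \<eta> p (ext_vf p u p) * \<eta> p (ext_vf p v p)"
    using contact smooth_ext_vf unfolding almost_contact_pseudo_metric_def by blast
  then show ?thesis by (simp add: ext_vf_at)
qed

lemmas \<phi>_simps = linear_add[OF linear_\<phi>] linear_diff[OF linear_\<phi>] linear_cmul[OF linear_\<phi>]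
  linear_neg[OF linear_\<phi>] linear_0[OF linear_\<phi>]
lemmas \<eta>_simps = linear_add[OF linear_\<eta>] linear_diff[OF linear_\<eta>]
  linear_cmul[OF linear_\<eta>, unfolded real_scaleR_def] linear_neg[OF linear_\<eta>] linear_0[OF linear_\<eta>]

lemma g_\<xi>: "g p u (\<xi> p) = \<epsilon> * \<eta> p u" "g p (\<xi> p) u = \<epsilon> * \<eta> p u"
  using g_\<phi>[of p u "\<xi> p"] g_sym[of p u "\<xi> p"] by (simp_all add: \<phi>_\<xi> \<eta>_\<xi> g_simps)

lemma g_\<phi>_skew: "g p (\<phi> p u) v = - g p u (\<phi> p v)"
  using g_\<phi>[of p "\<phi> p u" v] by (simp add: \<eta>_\<phi> \<phi>_\<phi> g_simps g_\<xi>)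

lemma nabla_\<phi>:
  assumes "vf X" "vf Y"
  shows "nabla X (\<lambda>q. \<phi> q (Y q)) = (\<lambda>p. \<phi> p (nabla X Y p) - \<eta> p (Y p) *\<^sub>R \<phi> p (X p)
    - (\<epsilon> * g p (X p) (\<phi> p (Y p))) *\<^sub>R \<xi> p)"
proof
  fix p
  have "nabla X (\<lambda>q. \<phi> q (Y q)) p - \<phi> p (nabla X Y p) =
          - (\<eta> p (Y p) *\<^sub>R \<phi> p (X p)) - (\<epsilon> * g p (X p) (\<phi> p (Y p))) *\<^sub>R \<xi> p"
    using kenmotsu assms unfolding kenmotsu_pseudo_metric_def by blast
  then show "nabla X (\<lambda>q. \<phi> q (Y q)) p = \<phi> p (nabla X Y p) - \<eta> p (Y p) *\<^sub>R \<phi> p (X p)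
    - (\<epsilon> * g p (X p) (\<phi> p (Y p))) *\<^sub>R \<xi> p" by (simp add: algebra_simps)
qed

text \<open>
  Differentiating \<open>\<phi> \<xi> = 0\<close> gives \<open>\<phi> (\<nabla>\<^sub>X \<xi>) = \<phi> X\<close>, which determines \<open>\<nabla>\<^sub>X \<xi>\<close> up to a multiple of
  \<open>\<xi>\<close>. As \<open>g(\<xi>,\<xi>)\<close> is constant, \<open>\<nabla>\<^sub>X \<xi>\<close> is orthogonal to \<open>\<xi>\<close>.
\<close>

lemma nabla_\<xi>:
  assumes X: "vf X"
  shows "nabla X \<xi> = (\<lambda>p. X p - \<eta> p (X p) *\<^sub>R \<xi> p)"
proof
  fix p
  have "(\<lambda>q. \<phi> q (\<xi> q)) = (\<lambda>q. 0)" by (simp add: \<phi>_\<xi>)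
  then have "nabla X (\<lambda>q. \<phi> q (\<xi> q)) p = 0" by (simp add: nabla_0 X)
  then have "\<phi> p (nabla X \<xi> p) = \<phi> p (X p)"
    unfolding nabla_\<phi>[OF X smooth_\<xi>] by (simp add: \<eta>_\<xi> \<phi>_\<xi> g_simps)
  then have "\<phi> p (\<phi> p (nabla X \<xi> p)) = \<phi> p (\<phi> p (X p))" by simp
  then have e: "- nabla X \<xi> p + \<eta> p (nabla X \<xi> p) *\<^sub>R \<xi> p = - X p + \<eta> p (X p) *\<^sub>R \<xi> p" by (simp add: \<phi>_\<phi>)
  have "(\<lambda>q. g q (\<xi> q) (\<xi> q)) = (\<lambda>q. \<epsilon>)" by (simp add: g_\<xi> \<eta>_\<xi>)
  then have "0 = g p (nabla X \<xi> p) (\<xi> p) + g p (\<xi> p) (nabla X \<xi> p)"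
    using vf_deriv_g[OF X smooth_\<xi> smooth_\<xi>, of p] by (simp add: vf_deriv_const)
  then have "\<epsilon> * \<eta> p (nabla X \<xi> p) = 0" by (simp add: g_\<xi>)
  then have "\<eta> p (nabla X \<xi> p) = 0" using eps(1) by auto
  with e show "nabla X \<xi> p = X p - \<eta> p (X p) *\<^sub>R \<xi> p" by (simp add: algebra_simps)
qed

lemma vf_deriv_\<eta>:
  assumes X: "vf X" and Y: "vf Y"
  shows "vf_deriv A X (\<lambda>q. \<eta> q (Y q)) p =
    \<eta> p (nabla X Y p) + \<epsilon> * g p (X p) (Y p) - \<eta> p (X p) * \<eta> p (Y p)"
proof -
  have "(\<lambda>q. \<eta> q (Y q)) = (\<lambda>q. \<epsilon> * g q (Y q) (\<xi> q))" by (simp add: g_\<xi> eps)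
  then have "vf_deriv A X (\<lambda>q. \<eta> q (Y q)) p = \<epsilon> * vf_deriv A X (\<lambda>q. g q (Y q) (\<xi> q)) p"
    using vf_deriv_mult_fun[OF smooth_fun_const[of \<epsilon>] smooth_g[OF Y smooth_\<xi>], of X p]
    by (simp add: vf_deriv_const)
  also have "\<dots> = \<epsilon> * (g p (nabla X Y p) (\<xi> p) + g p (Y p) (X p - \<eta> p (X p) *\<^sub>R \<xi> p))"
    by (simp add: vf_deriv_g X Y smooth_\<xi> nabla_\<xi>)
  also have "\<dots> = \<eta> p (nabla X Y p) + \<epsilon> * g p (X p) (Y p) - \<eta> p (X p) * \<eta> p (Y p)"
    using g_sym[of p "Y p" "X p"] by (simp add: g_simps g_\<xi> eps algebra_simps)
  finally show ?thesis .
qed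

text \<open>
  Differentiate \<open>nabla_\<xi>\<close> again. The terms along \<open>\<xi>\<close> cancel because \<open>vf_deriv_\<eta>\<close> makes the covariant
  derivative of \<open>\<eta>\<close> symmetric.
\<close>

lemma R_\<xi>:
  assumes X: "vf X" and Y: "vf Y"
  shows "R X Y \<xi> p = \<eta> p (X p) *\<^sub>R Y p - \<eta> p (Y p) *\<^sub>R X p"
proof -
  have d2: "nabla U (nabla V \<xi>) p = nabla U V p - \<eta> p (V p) *\<^sub>R (U p - \<eta> p (U p) *\<^sub>R \<xi> p)
     - (\<eta> p (nabla U V p) + \<epsilon> * g p (U p) (V p) - \<eta> p (U p) * \<eta> p (V p)) *\<^sub>R \<xi> p"
    if "vf U" "vf V" for U V
    by (simp add: nabla_\<xi> that nabla_diff nabla_scale smooth_\<eta> smooth_\<xi> smooth_vf_scaleR vf_deriv_\<eta> algebra_simps)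
  show ?thesis
    unfolding curvature_def d2[OF X Y] d2[OF Y X] nabla_\<xi>[OF smooth_vf_lie_bracket[OF X Y]]
    using g_sym[of p "Y p" "X p"] by (simp add: lie_bracket_eq X Y \<eta>_simps algebra_simps)
qed

text \<open>
  Differentiate \<open>nabla_\<phi>\<close> again and antisymmetrise. The terms with derivatives of the vector fields
  cancel, since the torsion vanishes, and so do those symmetric in \<open>X\<close> and \<open>Y\<close>.
\<close>

lemma R_\<phi>:
  assumes X: "vf X" and Y: "vf Y" and Z: "vf Z"
  shows "R X Y (\<lambda>q. \<phi> q (Z q)) p - \<phi> p (R X Y Z p) =
    \<epsilon> *\<^sub>R (g p (Y p) (Z p) *\<^sub>R \<phi> p (X p) - g p (X p) (Z p) *\<^sub>R \<phi> p (Y p)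
      + g p (X p) (\<phi> p (Z p)) *\<^sub>R Y p - g p (Y p) (\<phi> p (Z p)) *\<^sub>R X p)"
proof -
  have d2: "nabla U (nabla V (\<lambda>q. \<phi> q (Z q))) p =
      \<phi> p (nabla U (nabla V Z) p) - \<eta> p (nabla V Z p) *\<^sub>R \<phi> p (U p) - (\<epsilon> * g p (U p) (\<phi> p (nabla V Z p))) *\<^sub>R \<xi> p
      - (\<eta> p (Z p) *\<^sub>R (\<phi> p (nabla U V p) - \<eta> p (V p) *\<^sub>R \<phi> p (U p) - (\<epsilon> * g p (U p) (\<phi> p (V p))) *\<^sub>R \<xi> p)
        + (\<eta> p (nabla U Z p) + \<epsilon> * g p (U p) (Z p) - \<eta> p (U p) * \<eta> p (Z p)) *\<^sub>R \<phi> p (V p))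
      - ((\<epsilon> * g p (V p) (\<phi> p (Z p))) *\<^sub>R (U p - \<eta> p (U p) *\<^sub>R \<xi> p)
        + (\<epsilon> * (g p (nabla U V p) (\<phi> p (Z p)) + g p (V p) (\<phi> p (nabla U Z p) - \<eta> p (Z p) *\<^sub>R \<phi> p (U p)
            - (\<epsilon> * g p (U p) (\<phi> p (Z p))) *\<^sub>R \<xi> p))) *\<^sub>R \<xi> p)"
    if U: "vf U" and V: "vf V" for U V
  proof -
    have b: "sf (\<lambda>q. \<epsilon> * g q (V q) (\<phi> q (Z q)))"
      by (intro smooth_fun_mult smooth_fun_const smooth_g smooth_\<phi> V Z)
    have db: "vf_deriv A U (\<lambda>q. \<epsilon> * g q (V q) (\<phi> q (Z q))) p =
      \<epsilon> * (g p (nabla U V p) (\<phi> p (Z p)) + g p (V p) (\<phi> p (nabla U Z p) - \<eta> p (Z p) *\<^sub>R \<phi> p (U p)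
            - (\<epsilon> * g p (U p) (\<phi> p (Z p))) *\<^sub>R \<xi> p))"
      using vf_deriv_mult_fun[OF smooth_fun_const[of \<epsilon>] smooth_g[OF V smooth_\<phi>[OF Z]], of U p]
      by (simp add: vf_deriv_const vf_deriv_g U V Z smooth_\<phi> nabla_\<phi>)
    show ?thesis
      unfolding nabla_\<phi>[OF V Z]
      by (simp add: nabla_diff nabla_scale U V Z smooth_\<phi> smooth_nabla smooth_vf_scaleR smooth_vf_diff
          smooth_\<eta> smooth_\<xi> b nabla_\<phi> nabla_\<xi> vf_deriv_\<eta> db)
  qed
  have skew: "g p (Y p) (\<phi> p (X p)) = - g p (X p) (\<phi> p (Y p))"
    using g_\<phi>_skew[of p "X p" "Y p"] g_sym[of p "Y p" "\<phi> p (X p)"] by simp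
  show ?thesis
    unfolding curvature_def d2[OF X Y] d2[OF Y X] nabla_\<phi>[OF smooth_vf_lie_bracket[OF X Y] Z]
    by (simp add: lie_bracket_eq[OF X Y] \<eta>_simps \<phi>_simps g_simps g_\<xi> \<eta>_\<phi> eps skew algebra_simps)
qed

text \<open>The deviation of the curvature tensor from that of constant curvature \<open>-\<epsilon>\<close>.\<close>

definition reduced_curv :: "'m \<Rightarrow> 'e \<Rightarrow> 'e \<Rightarrow> 'e \<Rightarrow> 'e" where
  "reduced_curv p u v w = curv_at p u v w + \<epsilon> *\<^sub>R const_curv (g p) u v w"

text \<open>
  The right-hand sides of \<open>R_\<xi>\<close> and \<open>R_\<phi>\<close> are what \<open>-\<epsilon> B\<close> yields in place of \<open>R\<close>, with \<open>B\<close> the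
  tensor \<open>const_curv (g p)\<close>, so they drop out of the reduced tensor.
\<close>

lemma contact_curvature_at:
  assumes n: "DIM('e) = 2 * n + 1" "n \<ge> 2"
  shows "contact_curvature (g p) n (\<phi> p) (\<xi> p) (\<eta> p) \<epsilon> (reduced_curv p)"
proof -
  interpret nondegenerate_form "g p" by (rule form_at)
  have xi: "curv_at p u v (\<xi> p) = \<eta> p u *\<^sub>R v - \<eta> p v *\<^sub>R u" for u v
    using R_\<xi>[of "ext_vf p u" "ext_vf p v" p] by (simp add: R_eq_curv_at smooth_ext_vf ext_vf_at smooth_\<xi>)
  have ph: "curv_at p u v (\<phi> p w) - \<phi> p (curv_at p u v w) =
    \<epsilon> *\<^sub>R (g p v w *\<^sub>R \<phi> p u - g p u w *\<^sub>R \<phi> p v + g p u (\<phi> p w) *\<^sub>R v - g p v (\<phi> p w) *\<^sub>R u)" for u v w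
    using R_\<phi>[of "ext_vf p u" "ext_vf p v" "ext_vf p w" p]
    by (simp add: R_eq_curv_at smooth_ext_vf ext_vf_at smooth_\<phi>)
  show ?thesis
  proof (intro contact_curvature.intro contact_curvature_axioms.intro form_at)
    show "DIM('e) = 2 * n + 1" "n \<ge> 2" by (fact n)+
    show "linear (\<phi> p)" "linear (\<eta> p)" by (rule linear_\<phi> linear_\<eta>)+
    show "\<epsilon> * \<epsilon> = 1" by (rule eps)
    fix u v w z
    show "\<phi> p (\<phi> p v) = - v + \<eta> p v *\<^sub>R \<xi> p" by (rule \<phi>_\<phi>)
    show "\<eta> p (\<xi> p) = 1" by (rule \<eta>_\<xi>)
    show "\<phi> p (\<xi> p) = 0" by (rule \<phi>_\<xi>)
    show "\<eta> p (\<phi> p v) = 0" by (rule \<eta>_\<phi>)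
    show "g p (\<phi> p u) (\<phi> p v) = g p u v - \<epsilon> * \<eta> p u * \<eta> p v" by (rule g_\<phi>)
    show "trilinear (reduced_curv p)"
      using trilinear_curv_at[of p] trilinear_const_curv unfolding trilinear_def reduced_curv_def[abs_def]
      by (auto intro!: linear_compose_add linear_compose_scale_right)
    show "reduced_curv p u v w = - reduced_curv p v u w"
      by (simp add: reduced_curv_def const_curv_def curv_at_skew[of p u v w] algebra_simps)
    show "g p (reduced_curv p u v w) z = - g p w (reduced_curv p u v z)"
      using g_sym[of p w u] g_sym[of p w v]
      by (simp add: reduced_curv_def const_curv_def curv_at_g_skew[of p u v w z] g_simps algebra_simps)
    show "reduced_curv p u v w + reduced_curv p v w u + reduced_curv p w u v = 0"
      using curv_at_bianchi[of p u v w] g_sym[of p u v] g_sym[of p u w] g_sym[of p v w]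
      by (simp add: reduced_curv_def const_curv_def algebra_simps)
    show "reduced_curv p u v (\<xi> p) = 0"
      by (simp add: reduced_curv_def const_curv_def xi g_\<xi> eps algebra_simps)
    show "reduced_curv p u v (\<phi> p w) = \<phi> p (reduced_curv p u v w)"
      using ph[of u v w] by (simp add: reduced_curv_def const_curv_def \<phi>_simps algebra_simps)
  qed
qed

end

theorem theorem5:
  fixes A :: "('m::{t2_space, second_countable_topology}, 'e::euclidean_space) chart set"
    and n :: nat
    and \<phi> :: "'m \<Rightarrow> 'e \<Rightarrow> 'e"
    and \<xi> :: "'m \<Rightarrow> 'e"
    and \<eta> :: "'m \<Rightarrow> 'e \<Rightarrow> real"
    and g :: "'m \<Rightarrow> 'e \<Rightarrow> 'e \<Rightarrow> real"
    and \<epsilon> :: real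
    and nabla :: "('m \<Rightarrow> 'e) \<Rightarrow> ('m \<Rightarrow> 'e) \<Rightarrow> 'm \<Rightarrow> 'e"
  assumes "smooth_atlas A"
    and "DIM('e) = 2 * n + 1"
    and "DIM('e) > 3"
    and "kenmotsu_pseudo_metric A \<phi> \<xi> \<eta> g \<epsilon> nabla"
  shows "phi_conformally_flat n A \<phi> g nabla \<longleftrightarrow> constant_curvature A g nabla (- \<epsilon>)"
proof -
  interpret kenmotsu_manifold A g nabla \<phi> \<xi> \<eta> \<epsilon>
    using assms(1,4) by unfold_locales (simp_all add: kenmotsu_pseudo_metric_def almost_contact_pseudo_metric_def)
  have n: "n \<ge> 2" using assms(2,3) by simp
  \<comment> \<open>Both sides of the equivalence become conditions on the reduced tensor at each point.\<close>
  have weyl: "weyl_of n (g p) (curv_at p) u v w = weyl_of n (g p) (reduced_curv p) u v w" for p u v w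
    by (rule nondegenerate_form.weyl_of_shift[OF form_at trilinear_curv_at assms(2), where k=\<epsilon>, symmetric])
       (use n in \<open>simp_all add: reduced_curv_def\<close>)
  have const: "constant_curvature A g nabla (- \<epsilon>) \<longleftrightarrow> (\<forall>p u v w. reduced_curv p u v w = 0)"
    by (simp add: constant_curvature_iff reduced_curv_def add_eq_0_iff2)
  have flat: "phi_conformally_flat n A \<phi> g nabla \<longleftrightarrow>
    (\<forall>p u v w. \<phi> p (\<phi> p (weyl_of n (g p) (reduced_curv p) (\<phi> p u) (\<phi> p v) (\<phi> p w))) = 0)"
    (is "_ \<longleftrightarrow> ?flat")
  proof
    assume f: "phi_conformally_flat n A \<phi> g nabla"
    show ?flat
    proof (intro allI)
      fix p u v w
      have "\<phi> p (\<phi> p (conformal_curvature n A g nabla (\<lambda>q. \<phi> q (ext_vf p u q)) (\<lambda>q. \<phi> q (ext_vf p v q))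
          (\<lambda>q. \<phi> q (ext_vf p w q)) p)) = 0"
        using f smooth_ext_vf unfolding phi_conformally_flat_def by blast
      then show "\<phi> p (\<phi> p (weyl_of n (g p) (reduced_curv p) (\<phi> p u) (\<phi> p v) (\<phi> p w))) = 0"
        by (simp add: conformal_curvature_eq smooth_\<phi> smooth_ext_vf ext_vf_at weyl)
    qed
  qed (simp add: phi_conformally_flat_def conformal_curvature_eq smooth_\<phi> weyl)
  show ?thesis
  proof
    assume "phi_conformally_flat n A \<phi> g nabla"
    then have f: "\<And>p u v w. \<phi> p (\<phi> p (weyl_of n (g p) (reduced_curv p) (\<phi> p u) (\<phi> p v) (\<phi> p w))) = 0"
      unfolding flat by blast
    show "constant_curvature A g nabla (- \<epsilon>)"
      unfolding const by (intro allI contact_curvature.flat_imp_zero[OF contact_curvature_at[OF assms(2) n]] f)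
  next
    assume "constant_curvature A g nabla (- \<epsilon>)"
    then have z: "reduced_curv p = (\<lambda>u v w. 0)" for p by (intro ext) (simp add: const)
    have "weyl_of n (g p) (reduced_curv p) u v w = 0" for p u v w
    proof -
      interpret nondegenerate_form "g p" by (rule form_at)
      have "trilinear (reduced_curv p)" by (simp add: z trilinear_def linear_zero)
      moreover have ric: "ric_of (reduced_curv p) a b = 0" for a b
        by (simp add: ric_of_def z lin_trace_zero)
      ultimately have op: "ricop_of (g p) (reduced_curv p) a = 0" for a
        by (intro eqI) (simp add: g_ricop_of g_simps)
      have "lin_trace (ricop_of (g p) (reduced_curv p)) = 0" by (simp add: lin_trace_def op)
      then show ?thesis by (simp add: weyl_of_def ric op) (simp add: z)
    qed
    then show "phi_conformally_flat n A \<phi> g nabla"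
      unfolding flat by (simp add: \<phi>_simps)
  qed
qed

end
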